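(* Let $p$ be a prime, let $d\ge 1$, and let $G\le W_p$ be a topologically $d$-generated pro-$p$ group (a closed subgroup of $W_p$), with normalized Haar measure $\mu$, such that $\mathrm{FPP}(G)=0$. Then, if $k\ge d$, a $k$-generated random subgroup of $G$ has null fixed-point proportion with probability at least $$\prod_{j=0}^{d-1}\left(1-\frac{1}{p^{k-j}}\right),$$ that is, $$\mu^k\left(\left\{(g_1,\dots,g_k)\in G^k:\mathrm{FPP}(\langle g_1,\dots,g_k\rangle)=0\right\}\right)\ \ge\ \prod_{j=0}^{d-1}\left(1-\frac{1}{p^{k-j}}\right).$$ In particular this probability tends to $1$ as $k\to\infty$.
   Context: Let $T$ be the $p$-regular rooted tree, identified with the free monoid on $X=\{1,\dots,p\}$: vertices are finite words over $X$, the root is the empty word, and each vertex $v$ is adjacent to its $p$ descendants $vx$, $x\in X$. The $n$-th level $\mathcal{L}_n$ is the set of words of length $n$, and $T^n$ is the finite rooted tree of vertices at distance at most $n$ from the root. $\mathrm{Aut}(T)$ is the group of graph automorphisms of $T$ fixing the root, acting on the right; $v\cdot g$ is the image of $v$ under $g$. $\mathrm{St}(n)$ is the pointwise stabilizer of $\mathcal{L}_n$; the subgroups $\mathrm{St}(n)$, $n\ge1$, form a basis of neighborhoods of the identity for the congruence topology, making $\mathrm{Aut}(T)$ profinite; topological notions refer to this topology. The projection $\pi_n:\mathrm{Aut}(T)\to \mathrm{Aut}(T)/\mathrm{St}(n)\cong\mathrm{Aut}(T^n)$ records the action on the first $n$ levels. For $g\in\mathrm{Aut}(T)$ and a vertex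 $v$, the label $g|_v^1\in\mathrm{Sym}(p)$ is the permutation of $X$ determined by $(vx)\cdot g=(v\cdot g)(x\cdot g|_v^1)$ for $x\in X$. Let $\sigma\in\mathrm{Sym}(p)$ be a $p$-cycle. The group $W_p$ is the iterated wreath product $W_p=\{g\in\mathrm{Aut}(T): g|_v^1\in\langle\sigma\rangle\text{ for all vertices }v\}$. For any subgroup $H\le\mathrm{Aut}(T)$ (not necessarily closed), the fixed-point proportion is $$\mathrm{FPP}(H)=\lim_{n\to\infty}\frac{\#\{h\in\pi_n(H): h\text{ fixes a vertex in }\mathcal{L}_n\}}{|\pi_n(H)|}.$$ $G$ is topologically $d$-generated if it contains a dense subgroup generated by $d$ elements. $\mu$ denotes the unique normalized Haar measure on $G$, and $\mu^k$ the product measure on $G^k$. A $k$-generated random subgroup of $G$ is the (abstract) subgroup generated by $k$ independent Haar-random elements of $G$. *)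

theory Defs
  imports "HOL-Analysis.Analysis" "HOL-Algebra.Sym_Groups" "HOL-Algebra.Generated_Groups"
begin

section \<open>The regular rooted tree and its automorphism group\<close>

definition tree :: "nat \<Rightarrow> nat list set" where
  "tree p = lists {1..p}"

definition level :: "nat \<Rightarrow> nat \<Rightarrow> nat list set" where
  "level p n = {v \<in> tree p. length v = n}"

definition tree_adj :: "nat \<Rightarrow> nat list \<Rightarrow> nat list \<Rightarrow> bool" where
  "tree_adj p u v \<longleftrightarrow> (\<exists>x\<in>{1..p}. v = u @ [x] \<or> u = v @ [x])"

text \<open>Automorphisms act on the right, so \<open>g \<otimes> h\<close> means first \<open>g\<close>, then \<open>h\<close>. Outside the
  vertex set every automorphism takes the value \<^const>\<open>undefined\<close>, which makes it determined by its
  action on the tree.\<close>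

definition AutT :: "nat \<Rightarrow> (nat list \<Rightarrow> nat list) monoid" where
  "AutT p = \<lparr>carrier = {g \<in> extensional (tree p). bij_betw g (tree p) (tree p) \<and> g [] = [] \<and>
       (\<forall>u\<in>tree p. \<forall>v\<in>tree p. tree_adj p u v \<longleftrightarrow> tree_adj p (g u) (g v))},
     mult = (\<lambda>g h. compose (tree p) h g),
     one = (\<lambda>v\<in>tree p. v)\<rparr>"

lemma carrier_AutT_iff:
  "g \<in> carrier (AutT p) \<longleftrightarrow> g \<in> extensional (tree p) \<and> bij_betw g (tree p) (tree p) \<and> g [] = [] \<and>
     (\<forall>u\<in>tree p. \<forall>v\<in>tree p. tree_adj p u v \<longleftrightarrow> tree_adj p (g u) (g v))"
  by (simp add: AutT_def)

lemma AutT_closed: "g \<in> carrier (AutT p) \<Longrightarrow> v \<in> tree p \<Longrightarrow> g v \<in> tree p"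
  by (meson carrier_AutT_iff bij_betwE)

lemma AutT_adj:
  "g \<in> carrier (AutT p) \<Longrightarrow> u \<in> tree p \<Longrightarrow> v \<in> tree p \<Longrightarrow> tree_adj p (g u) (g v) \<longleftrightarrow> tree_adj p u v"
  by (simp add: carrier_AutT_iff)

lemma Nil_in_tree: "[] \<in> tree p"
  by (simp add: tree_def)

lemma mult_AutT: "g \<otimes>\<^bsub>AutT p\<^esub> h = compose (tree p) h g"
  by (simp add: AutT_def)

lemma one_AutT: "\<one>\<^bsub>AutT p\<^esub> = (\<lambda>v\<in>tree p. v)"
  by (simp add: AutT_def)

lemma group_AutT: "group (AutT p)"
proof (rule groupI)
  show "x \<otimes>\<^bsub>AutT p\<^esub> y \<in> carrier (AutT p)"
    if x: "x \<in> carrier (AutT p)" and y: "y \<in> carrier (AutT p)" for x y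
  proof -
    have "bij_betw (compose (tree p) y x) (tree p) (tree p)"
      using x y by (meson bij_betw_compose carrier_AutT_iff)
    moreover have "x [] = []" "y [] = []"
      using x y by (simp_all add: carrier_AutT_iff)
    ultimately show ?thesis
      unfolding mult_AutT carrier_AutT_iff[of "compose _ _ _"]
      by (simp add: compose_eq Nil_in_tree AutT_adj[OF x] AutT_adj[OF y] AutT_closed[OF x])
  qed
  show "\<one>\<^bsub>AutT p\<^esub> \<in> carrier (AutT p)"
    by (simp add: one_AutT carrier_AutT_iff Nil_in_tree bij_betw_def inj_on_def)
  show "x \<otimes>\<^bsub>AutT p\<^esub> y \<otimes>\<^bsub>AutT p\<^esub> z = x \<otimes>\<^bsub>AutT p\<^esub> (y \<otimes>\<^bsub>AutT p\<^esub> z)"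
    if "x \<in> carrier (AutT p)" for x y z
    using AutT_closed[OF that] by (simp add: mult_AutT compose_def fun_eq_iff)
  show "\<one>\<^bsub>AutT p\<^esub> \<otimes>\<^bsub>AutT p\<^esub> x = x" if "x \<in> carrier (AutT p)" for x
    using that by (simp add: mult_AutT one_AutT compose_def fun_eq_iff carrier_AutT_iff extensional_def)
  show "\<exists>y\<in>carrier (AutT p). y \<otimes>\<^bsub>AutT p\<^esub> x = \<one>\<^bsub>AutT p\<^esub>" if x: "x \<in> carrier (AutT p)" for x
  proof -
    let ?i = "inv_into (tree p) x"
    let ?y = "\<lambda>v\<in>tree p. ?i v"
    have bij: "bij_betw x (tree p) (tree p)" and x0: "x [] = []"
      using x by (simp_all add: carrier_AutT_iff)
    have bij': "bij_betw ?i (tree p) (tree p)"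
      by (rule bij_betw_inv_into[OF bij])
    have xy: "x (?i v) = v" if "v \<in> tree p" for v
      using bij that by (simp add: bij_betw_inv_into_right)
    have yin: "?i v \<in> tree p" if "v \<in> tree p" for v
      using bij_betwE[OF bij'] that by blast
    have y0: "?i [] = []"
      using bij_betw_inv_into_left[OF bij Nil_in_tree] x0 by simp
    have "bij_betw ?y (tree p) (tree p)"
      using bij' by (subst bij_betw_cong[where g = ?i]) simp_all
    moreover have "tree_adj p u v \<longleftrightarrow> tree_adj p (?i u) (?i v)"
      if "u \<in> tree p" "v \<in> tree p" for u v
      using AutT_adj[OF x yin[OF that(1)] yin[OF that(2)]] that by (simp add: xy)
    ultimately have "?y \<in> carrier (AutT p)"
      by (simp add: carrier_AutT_iff Nil_in_tree y0)
    moreover have "?y \<otimes>\<^bsub>AutT p\<^esub> x = \<one>\<^bsub>AutT p\<^esub>"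
      using xy by (simp add: mult_AutT one_AutT compose_def fun_eq_iff)
    ultimately show ?thesis by blast
  qed
qed

lemma AutT_child:
  assumes g: "g \<in> carrier (AutT p)" and "v \<in> tree p" "x \<in> {1..p}"
  shows "\<exists>y\<in>{1..p}. g (v @ [x]) = g v @ [y]"
  using assms(2,3)
proof (induction v arbitrary: x rule: rev_induct)
  case Nil
  have "[x] \<in> tree p" "tree_adj p [] [x]"
    using Nil by (auto simp: tree_adj_def tree_def)
  then have "tree_adj p (g []) (g [x])"
    using AutT_adj[OF g Nil_in_tree] by blast
  moreover have "g [] = []"
    using g by (simp add: carrier_AutT_iff)
  ultimately show ?case
    by (simp add: tree_adj_def)
next
  case (snoc z w)
  have w: "w \<in> tree p" "z \<in> {1..p}" "w @ [z, x] \<in> tree p"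
    using snoc.prems by (auto simp: tree_def)
  obtain y where y: "g (w @ [z]) = g w @ [y]"
    using snoc.IH[OF w(1,2)] by blast
  have "tree_adj p (w @ [z]) (w @ [z, x])"
    using snoc.prems(2) by (auto simp: tree_adj_def)
  then have *: "tree_adj p (g w @ [y]) (g (w @ [z, x]))"
    using AutT_adj[OF g snoc.prems(1) w(3)] y by simp
  have "inj_on g (tree p)"
    using g by (auto simp: carrier_AutT_iff bij_betw_def)
  then have "g (w @ [z, x]) \<noteq> g w"
    using w by (auto dest: inj_onD)
  then show ?case
    using * y by (auto simp: tree_adj_def)
qed

lemma AutT_append:
  assumes "g \<in> carrier (AutT p)" "v @ w \<in> tree p"
  shows "\<exists>w'. length w' = length w \<and> g (v @ w) = g v @ w'"
  using assms(2)
proof (induction w rule: rev_induct)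
  case (snoc x w)
  then have vw: "v @ w \<in> tree p" "x \<in> {1..p}"
    by (auto simp: tree_def)
  obtain w' where "length w' = length w" "g (v @ w) = g v @ w'"
    using snoc.IH[OF vw(1)] by auto
  moreover obtain y where "g (v @ w @ [x]) = g (v @ w) @ [y]"
    using AutT_child[OF assms(1) vw] by auto
  ultimately show ?case
    by (intro exI[of _ "w' @ [y]"]) simp
qed simp

lemma length_AutT:
  assumes "g \<in> carrier (AutT p)" "v \<in> tree p"
  shows "length (g v) = length v"
  using AutT_append[of g p "[]" v] assms by (auto simp: carrier_AutT_iff)

section \<open>The congruence topology\<close>

definition St :: "nat \<Rightarrow> nat \<Rightarrow> (nat list \<Rightarrow> nat list) set" where
  "St p n = {g \<in> carrier (AutT p). \<forall>v\<in>level p n. g v = v}"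

definition cong_top :: "nat \<Rightarrow> (nat list \<Rightarrow> nat list) topology" where
  "cong_top p = topology (\<lambda>U. U \<subseteq> carrier (AutT p) \<and>
     (\<forall>g\<in>U. \<exists>n\<ge>1. g <#\<^bsub>AutT p\<^esub> St p n \<subseteq> U))"

lemma St_antimono:
  assumes "m \<le> n" "n \<ge> 1"
  shows "St p n \<subseteq> St p m"
proof
  fix g assume g: "g \<in> St p n"
  then have carr: "g \<in> carrier (AutT p)" by (simp add: St_def)
  have "g v = v" if v: "v \<in> level p m" for v
  proof (cases "p = 0")
    case True
    then have "v = []" using v by (auto simp: level_def tree_def)
    then show ?thesis using carr by (simp add: carrier_AutT_iff)
  next
    case False
    define w where "w = replicate (n - m) (1::nat)"
    have vw: "v @ w \<in> level p n"
      using v False assms(1) by (auto simp: level_def tree_def w_def)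
    then obtain w' where "length w' = length w" "g (v @ w) = g v @ w'"
      using AutT_append[OF carr, of v w] by (auto simp: level_def)
    moreover have "g (v @ w) = v @ w"
      using g vw by (simp add: St_def)
    ultimately show ?thesis by simp
  qed
  then show "g \<in> St p m" using carr by (simp add: St_def)
qed

lemma openin_cong_top:
  "openin (cong_top p) U \<longleftrightarrow> U \<subseteq> carrier (AutT p) \<and>
     (\<forall>g\<in>U. \<exists>n\<ge>1. g <#\<^bsub>AutT p\<^esub> St p n \<subseteq> U)"
proof -
  let ?L = "\<lambda>U. U \<subseteq> carrier (AutT p) \<and> (\<forall>g\<in>U. \<exists>n\<ge>1. g <#\<^bsub>AutT p\<^esub> St p n \<subseteq> U)"
  have "?L (S \<inter> T)" if S: "?L S" and T: "?L T" for S T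
  proof (intro conjI ballI)
    show "S \<inter> T \<subseteq> carrier (AutT p)"
      using S by blast
  next
    fix g assume g: "g \<in> S \<inter> T"
    obtain m n where mn: "m \<ge> 1" "g <#\<^bsub>AutT p\<^esub> St p m \<subseteq> S" "n \<ge> 1" "g <#\<^bsub>AutT p\<^esub> St p n \<subseteq> T"
      using S T g by (meson IntE)
    have "St p (max m n) \<subseteq> St p m" "St p (max m n) \<subseteq> St p n"
      using mn(1) by (intro St_antimono; simp)+
    then have "g <#\<^bsub>AutT p\<^esub> St p (max m n) \<subseteq> S \<inter> T"
      using mn unfolding l_coset_def by blast
    then show "\<exists>n\<ge>1. g <#\<^bsub>AutT p\<^esub> St p n \<subseteq> S \<inter> T"
      using mn(1) by (intro exI[of _ "max m n"]) auto
  qed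
  moreover have "?L (\<Union>K)" if "\<forall>S\<in>K. ?L S" for K
  proof (intro conjI ballI)
    show "\<Union>K \<subseteq> carrier (AutT p)"
      using that by blast
  next
    fix g assume "g \<in> \<Union>K"
    then obtain S where S: "S \<in> K" "g \<in> S" by blast
    have "\<exists>n\<ge>1. g <#\<^bsub>AutT p\<^esub> St p n \<subseteq> S"
      using bspec[OF that S(1)] S(2) by simp
    then show "\<exists>n\<ge>1. g <#\<^bsub>AutT p\<^esub> St p n \<subseteq> \<Union>K"
      using S(1) by (meson Union_upper order_trans)
  qed
  ultimately have "istopology ?L"
    unfolding istopology_def by (intro conjI allI impI) simp_all
  then show ?thesis
    unfolding cong_top_def by (simp add: topology_inverse')
qed

lemma topspace_cong_top: "topspace (cong_top p) = carrier (AutT p)"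
proof -
  have "g <#\<^bsub>AutT p\<^esub> St p 1 \<subseteq> carrier (AutT p)" if "g \<in> carrier (AutT p)" for g
    using that group.l_coset_subset_G[OF group_AutT, of "St p 1" p g] by (auto simp: St_def)
  then have "openin (cong_top p) (carrier (AutT p))"
    by (auto simp: openin_cong_top)
  moreover have "topspace (cong_top p) \<subseteq> carrier (AutT p)"
    using openin_cong_top[of p "topspace (cong_top p)"] openin_topspace by blast
  ultimately show ?thesis
    using openin_subset by blast
qed

definition topologically_generated :: "nat \<Rightarrow> nat \<Rightarrow> (nat list \<Rightarrow> nat list) set \<Rightarrow> bool" where
  "topologically_generated p d G \<longleftrightarrow> (\<exists>g \<in> {..<d} \<rightarrow> G.
     Abstract_Topology.closure_of (subtopology (cong_top p) G) (generate (AutT p) (g ` {..<d})) = G)"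

text \<open>\<open>Aut(T)\<close> being profinite, its closed subgroups are profinite groups; such a group is
  pro-\<open>q\<close> when all its open normal subgroups have \<open>q\<close>-power index.\<close>

definition pro_subgroup :: "nat \<Rightarrow> nat \<Rightarrow> (nat list \<Rightarrow> nat list) set \<Rightarrow> bool" where
  "pro_subgroup q p G \<longleftrightarrow> subgroup G (AutT p) \<and> closedin (cong_top p) G \<and>
     (\<forall>N. N \<lhd> (AutT p)\<lparr>carrier := G\<rparr> \<and> openin (subtopology (cong_top p) G) N \<longrightarrow>
        (\<exists>m. card (rcosets\<^bsub>(AutT p)\<lparr>carrier := G\<rparr>\<^esub> N) = q ^ m))"

section \<open>The iterated wreath product\<close>

definition label :: "nat \<Rightarrow> (nat list \<Rightarrow> nat list) \<Rightarrow> nat list \<Rightarrow> nat \<Rightarrow> nat" where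
  "label p g v = (THE s. s \<in> carrier (sym_group p) \<and> (\<forall>x\<in>{1..p}. g (v @ [x]) = g v @ [s x]))"

definition p_cycles :: "nat \<Rightarrow> (nat \<Rightarrow> nat) set" where
  "p_cycles p = {cycle_of_list cs | cs. cycle cs \<and> length cs = p \<and> set cs \<subseteq> {1..p}}"

definition wreath :: "nat \<Rightarrow> (nat \<Rightarrow> nat) \<Rightarrow> (nat list \<Rightarrow> nat list) set" where
  "wreath p \<sigma> = {g \<in> carrier (AutT p).
     \<forall>v\<in>tree p. label p g v \<in> generate (sym_group p) {\<sigma>}}"

section \<open>Fixed-point proportion\<close>

text \<open>The quotient \<open>Aut(T)/St(n)\<close> is identified with \<open>Aut(T\<^sup>n)\<close>, so the projection restricts
  an automorphism to the vertices at distance at most \<open>n\<close> from the root.\<close>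

definition proj :: "nat \<Rightarrow> nat \<Rightarrow> (nat list \<Rightarrow> nat list) \<Rightarrow> nat list \<Rightarrow> nat list" where
  "proj p n g = restrict g {v \<in> tree p. length v \<le> n}"

definition FPP :: "nat \<Rightarrow> (nat list \<Rightarrow> nat list) set \<Rightarrow> real" where
  "FPP p H = lim (\<lambda>n. real (card {h \<in> proj p n ` H. \<exists>v\<in>level p n. h v = v}) /
                      real (card (proj p n ` H)))"

section \<open>Haar measure\<close>

text \<open>For a closed (hence compact metrizable) subgroup, a Borel probability measure is automatically
  regular and left invariance determines it uniquely and implies right invariance.\<close>

definition normalized_haar_measure ::
    "nat \<Rightarrow> (nat list \<Rightarrow> nat list) set \<Rightarrow> (nat list \<Rightarrow> nat list) measure \<Rightarrow> bool" where
  "normalized_haar_measure p G M \<longleftrightarrow>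
     space M = G \<and>
     sets M = sigma_sets G {U. openin (subtopology (cong_top p) G) U} \<and>
     emeasure M G = 1 \<and>
     (\<forall>g\<in>G. \<forall>A\<in>sets M. emeasure M (g <#\<^bsub>AutT p\<^esub> A) = emeasure M A)"

end

theory Submission
  imports Defs
    "HOL-Algebra.Group_Action"
    "HOL-Algebra.Zassenhaus"
    "HOL-Algebra.Multiplicative_Group"
    "HOL-Number_Theory.Cong"
    "HOL-Probability.Infinite_Product_Measure"
begin

text \<open>The fixed-point proportion of a subgroup of \<open>G\<close> depends only on its images in the finite quotients
  of \<open>G\<close> by level stabilizers. A tuple whose entries generate every one of these quotients, that is,
  a tuple that topologically generates \<open>G\<close>, therefore generates a subgroup with the same, null,
  fixed-point proportion (\<open>measure_null_FPP\<close>). It remains to bound from below the probability that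
  \<open>k\<close> random elements generate topologically. These events decrease with the level, so it suffices to
  treat one finite quotient at a time, and there Haar measure becomes counting
  (\<open>measure_generates_level\<close>): the claim is that in a finite \<open>p\<close>-group with \<open>d\<close> generators
  \<open>x 0, \<dots>, x (d - 1)\<close> at least the stated proportion of \<open>k\<close>-tuples generate
  (\<open>p_group_card_generating_tuples\<close>).

  In a finite \<open>p\<close>-group every proper subgroup lies in the kernel of a nonzero homomorphism to the
  cyclic group of order \<open>p\<close> (\<open>ex_mod_char_of_p_group\<close>), because maximal subgroups are normal. So a
  tuple generates unless such a homomorphism kills all its entries. The bad homomorphisms are removed
  in \<open>d\<close> rounds, round \<open>i\<close> dealing with those whose last nonzero value on a generator occurs at
  \<open>x i\<close>, normalized to have the value \<open>1\<close> there. There are at most \<open>p ^ i\<close> of them, and each kills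
  at most the fraction \<open>1 / p ^ k\<close> of the tuples that survived so far, because translating the
  entries by powers of \<open>x i\<close> preserves survival and makes the values of the homomorphism
  equidistributed (\<open>separated_step\<close>). Hence round \<open>i\<close> costs a factor of at worst
  \<open>1 - 1 / p ^ (k - i)\<close>.\<close>

section \<open>Maximal subgroups of finite \<open>p\<close>-groups\<close>

text \<open>Orbits have size dividing \<open>p ^ m\<close>, so those that are not single fixed points contribute a
  multiple of \<open>p\<close> to the size of the set acted on.\<close>
lemma (in group_action) p_group_fixed_points:
  assumes "prime p" "order G = p ^ m" "finite E"
  shows "card E mod p = card {x \<in> E. \<forall>g\<in>carrier G. \<phi> g x = x} mod p"
proof -
  let ?O = "orbits G E \<phi>"
  let ?S = "{A \<in> ?O. card A = 1}"
  define F where "F = {x \<in> E. \<forall>g\<in>carrier G. \<phi> g x = x}"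
  have finO: "finite ?O"
    using \<open>finite E\<close> by (simp add: orbits_def setcompr_eq_image)
  have dvd: "p dvd card A" if A: "A \<in> ?O" "card A \<noteq> 1" for A
  proof -
    obtain x where x: "x \<in> E" "A = orbit G \<phi> x"
      using A(1) by (auto simp: orbits_def)
    have "card A dvd p ^ m"
      using orbit_stabilizer_theorem[OF x(1)] x(2) assms(2) by (metis dvd_triv_left)
    then obtain i where "card A = p ^ i"
      using divides_primepow_nat[OF assms(1)] by blast
    with A(2) show ?thesis
      by (cases i) auto
  qed
  have fixed: "orbit G \<phi> x = {x}" if x: "x \<in> F" for x
  proof -
    have "orbit G \<phi> x \<subseteq> {x}"
      using x by (auto simp: orbit_def F_def)
    moreover have "x \<in> orbit G \<phi> x"
      using x by (simp add: F_def orbit_refl)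
    ultimately show ?thesis by blast
  qed
  have "{x} \<in> ?S" if "x \<in> F" for x
    using fixed[OF that] that by (auto simp: orbits_def F_def)
  moreover have "\<exists>x\<in>F. A = {x}" if AS: "A \<in> ?S" for A
  proof -
    obtain x where x: "x \<in> E" "A = orbit G \<phi> x" "card A = 1"
      using AS by (auto simp: orbits_def)
    then have A: "A = {x}"
      using orbit_refl[OF x(1)] by (auto simp: card_1_singleton_iff)
    moreover have "\<phi> g x = x" if "g \<in> carrier G" for g
      using x(2) A that by (auto simp: orbit_def)
    ultimately show ?thesis
      using x(1) by (auto simp: F_def)
  qed
  ultimately have "bij_betw (\<lambda>x. {x}) F ?S"
    by (intro bij_betw_imageI) (blast intro: inj_onI, blast)
  then have cF: "card F = card ?S"
    by (rule bij_betw_same_card)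
  have "card E = (\<Sum>A\<in>?O. \<Sum>x\<in>A. 1)"
    using disjoint_sum[OF \<open>finite E\<close>, of "\<lambda>_. 1::nat"] by simp
  also have "\<dots> = (\<Sum>A\<in>?O. card A)"
    by simp
  also have "\<dots> = (\<Sum>A\<in>?S. card A) + (\<Sum>A\<in>?O - ?S. card A)"
    using finO by (subst sum.subset_diff[of ?S]) auto
  also have "(\<Sum>A\<in>?S. card A) = card F"
    by (simp add: cF)
  finally have "card E = card F + (\<Sum>A\<in>?O - ?S. card A)" .
  moreover have "p dvd (\<Sum>A\<in>?O - ?S. card A)"
    by (rule dvd_sum) (use dvd in auto)
  ultimately show ?thesis
    unfolding F_def by (auto simp: mod_add_right_eq elim!: dvdE)
qed

lemma (in group) card_subgroup_of_p_group:
  assumes "prime p" "order G = p ^ m" "subgroup H G"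
  obtains i where "card H = p ^ i"
proof -
  have "card H dvd p ^ m"
    using lagrange[OF assms(3)] assms(2) by (metis dvd_triv_right)
  then show ?thesis
    using divides_primepow_nat[OF assms(1)] that by blast
qed

lemma (in group) coset_translation_action:
  assumes M: "subgroup M G"
  shows "group_action (G\<lparr>carrier := M\<rparr>) (rcosets M) (\<lambda>m. \<lambda>C\<in>rcosets M. C #> inv m)"
proof -
  have Mc: "M \<subseteq> carrier G" by (rule subgroup.subset[OF M])
  have sub: "C \<subseteq> carrier G" if "C \<in> rcosets M" for C
    using that subgroup.rcosets_carrier[OF M is_group] by blast
  have mem: "C #> g \<in> rcosets M" if "C \<in> rcosets M" "g \<in> carrier G" for C g
    using that Mc by (auto simp: RCOSETS_def coset_mult_assoc)
  have bij: "(\<lambda>C\<in>rcosets M. C #> g) \<in> Bij (rcosets M)" if g: "g \<in> carrier G" for g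
  proof -
    have "bij_betw (\<lambda>C. C #> g) (rcosets M) (rcosets M)"
      by (rule bij_betw_byWitness[where f' = "\<lambda>C. C #> inv g"])
        (use g mem sub in \<open>auto simp: coset_mult_assoc\<close>)
    then show ?thesis
      by (simp add: Bij_def bij_betw_cong[of _ "\<lambda>C\<in>rcosets M. C #> g" "\<lambda>C. C #> g"])
  qed
  have "(\<lambda>m. \<lambda>C\<in>rcosets M. C #> inv m) \<in> hom (G\<lparr>carrier := M\<rparr>) (BijGroup (rcosets M))"
  proof (rule homI)
    fix m assume "m \<in> carrier (G\<lparr>carrier := M\<rparr>)"
    then show "(\<lambda>C\<in>rcosets M. C #> inv m) \<in> carrier (BijGroup (rcosets M))"
      using Mc by (simp add: BijGroup_def bij subsetD)
  next
    fix m n assume mn: "m \<in> carrier (G\<lparr>carrier := M\<rparr>)" "n \<in> carrier (G\<lparr>carrier := M\<rparr>)"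
    then have c: "m \<in> carrier G" "n \<in> carrier G" using Mc by auto
    show "(\<lambda>C\<in>rcosets M. C #> inv (m \<otimes>\<^bsub>G\<lparr>carrier := M\<rparr>\<^esub> n)) =
        (\<lambda>C\<in>rcosets M. C #> inv m) \<otimes>\<^bsub>BijGroup (rcosets M)\<^esub> (\<lambda>C\<in>rcosets M. C #> inv n)"
      using c bij[of "inv m"] bij[of "inv n"]
      by (simp add: BijGroup_def compose_def fun_eq_iff restrict_def mem coset_mult_assoc[OF sub] inv_mult_group)
  qed
  then show ?thesis
    by (intro group_action.intro group_hom.intro group_hom_axioms.intro subgroup_imp_group[OF M] group_BijGroup)
qed

text \<open>Let \<open>M\<close> act by translation on its own cosets. Their number is a positive power of \<open>p\<close> and \<open>M\<close>
  itself is a fixed point, so there is a second fixed point \<open>M #> g\<close>. Being fixed means that \<open>g\<close>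
  normalizes \<open>M\<close>; the normalizer is therefore larger than \<open>M\<close>, and by maximality it is everything.\<close>
lemma (in group) p_group_maximal_subgroup_normal:
  assumes p: "prime p" "order G = p ^ m"
    and M: "subgroup M G" "M \<noteq> carrier G"
    and max: "\<And>K. subgroup K G \<Longrightarrow> M \<subseteq> K \<Longrightarrow> K \<noteq> carrier G \<Longrightarrow> K = M"
  shows "M \<lhd> G"
proof -
  have fin: "finite (carrier G)"
    using p by (metis order_gt_0_iff_finite prime_gt_0_nat zero_less_power)
  have Mc: "M \<subseteq> carrier G" by (rule subgroup.subset[OF M(1)])
  have finM: "finite M" using fin Mc finite_subset by blast
  interpret act: group_action "G\<lparr>carrier := M\<rparr>" "rcosets M" "\<lambda>m. \<lambda>C\<in>rcosets M. C #> inv m"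
    by (rule coset_translation_action[OF M(1)])
  obtain i where i: "card M = p ^ i"
    using card_subgroup_of_p_group[OF p M(1)] .
  define F where "F = {C \<in> rcosets M. \<forall>g\<in>carrier (G\<lparr>carrier := M\<rparr>). (\<lambda>C\<in>rcosets M. C #> inv g) C = C}"
  have finR: "finite (rcosets M)"
    using fin by (simp add: RCOSETS_def)
  have "order (G\<lparr>carrier := M\<rparr>) = p ^ i"
    using i by (simp add: order_def)
  then have "card (rcosets M) mod p = card F mod p"
    unfolding F_def using act.p_group_fixed_points[OF p(1) _ finR] by blast
  moreover have "p dvd card (rcosets M)"
  proof -
    have l: "card (rcosets M) * card M = p ^ m"
      using lagrange[OF M(1)] p(2) by simp
    then obtain j where j: "card (rcosets M) = p ^ j"
      using divides_primepow_nat[OF p(1)] by (metis dvd_triv_left)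
    have "card M \<noteq> order G"
      using M(2) Mc fin card_subset_eq[of "carrier G" M] by (auto simp: order_def)
    then have "j \<noteq> 0"
      using l j p(2) by (intro notI) simp
    then show ?thesis using j by simp
  qed
  ultimately have "p dvd card F"
    by (metis dvd_eq_mod_eq_0)
  moreover have MF: "M \<in> F"
    using M(1) Mc subgroup.rcos_const[OF M(1) is_group] subgroup.m_inv_closed[OF M(1)]
    by (auto simp: F_def subgroup.subgroup_in_rcosets is_group)
  moreover have "finite F"
    using finR by (simp add: F_def)
  ultimately have "card F > 1"
    using prime_ge_2_nat[OF p(1)] by (metis card_gt_0_iff dvd_imp_le empty_iff less_le_trans one_less_numeral_iff semiring_norm(76))
  then have "\<not> F \<subseteq> {M}"
    using card_mono[of "{M}" F] by auto
  then obtain C where C: "C \<in> F" "C \<noteq> M" by blast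
  then obtain g where g: "g \<in> carrier G" "C = M #> g"
    by (auto simp: F_def RCOSETS_def)
  have "g \<notin> M"
    using C(2) g subgroup.rcos_const[OF M(1) is_group] by blast
  have conj: "g \<otimes> h \<otimes> inv g \<in> M" if h: "h \<in> M" for h
  proof -
    have hc: "h \<in> carrier G" "inv h \<in> M" using h Mc subgroup.m_inv_closed[OF M(1)] by auto
    have "(M #> g) #> inv (inv h) = M #> g"
      using C(1) g hc(2) by (auto simp: F_def)
    then have "M #> (g \<otimes> h) = M #> g"
      using hc g Mc by (simp add: coset_mult_assoc)
    then show ?thesis
      using subgroup.rcos_module_imp[OF M(1) is_group g(1), of "g \<otimes> h"] rcos_self[of "g \<otimes> h" M] M(1) hc g
      by (metis m_closed m_assoc)
  qed
  \<comment> \<open>By finiteness, the injective map of conjugation by \<open>g\<close> from \<open>M\<close> into itself is onto.\<close>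
  have "(\<lambda>h. g \<otimes> h \<otimes> inv g) ` M = M"
    by (rule endo_inj_surj[OF finM]) (use conj g Mc in \<open>auto simp: inj_on_def subset_iff\<close>)
  moreover have "g <# M #> inv g = (\<lambda>h. g \<otimes> h \<otimes> inv g) ` M"
    by (auto simp: l_coset_def r_coset_def)
  ultimately have gN: "g \<in> normalizer G M"
    using g Mc by (simp add: normalizer_def stabilizer_def)
  have nor: "M \<lhd> G\<lparr>carrier := normalizer G M\<rparr>"
    by (rule subgroup_in_normalizer[OF M(1)])
  then have "M \<subseteq> normalizer G M"
    using subgroup.subset[OF normal_imp_subgroup[OF nor]] by simp
  then have "normalizer G M = carrier G"
    using max[OF normalizer_imp_subgroup[OF Mc]] gN \<open>g \<notin> M\<close> by blast
  then show ?thesis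
    using nor by simp
qed

section \<open>Homomorphisms to the cyclic group of order \<open>p\<close>\<close>

text \<open>The homomorphisms into the cyclic group of order \<open>p\<close>, with the residues \<open>0, \<dots>, p - 1\<close> as
  values. They are made extensional so that different functions are different homomorphisms, which
  is what counting them needs.\<close>
definition mod_chars :: "nat \<Rightarrow> ('a, 'b) monoid_scheme \<Rightarrow> ('a \<Rightarrow> nat) set" where
  "mod_chars p G = {\<phi> \<in> carrier G \<rightarrow>\<^sub>E {..<p}.
     \<forall>g\<in>carrier G. \<forall>h\<in>carrier G. \<phi> (g \<otimes>\<^bsub>G\<^esub> h) = (\<phi> g + \<phi> h) mod p}"

lemma mod_chars_mult:
  "\<phi> \<in> mod_chars p G \<Longrightarrow> g \<in> carrier G \<Longrightarrow> h \<in> carrier G \<Longrightarrow>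
     \<phi> (g \<otimes>\<^bsub>G\<^esub> h) = (\<phi> g + \<phi> h) mod p"
  by (simp add: mod_chars_def)

lemma mod_chars_less: "\<phi> \<in> mod_chars p G \<Longrightarrow> g \<in> carrier G \<Longrightarrow> \<phi> g < p"
  by (auto simp: mod_chars_def)

lemma (in group) mod_chars_one: "\<phi> \<in> mod_chars p G \<Longrightarrow> \<phi> \<one> = 0"
  using mod_chars_mult[of \<phi> p G \<one> \<one>] mod_chars_less[of \<phi> p G \<one>]
  by (auto simp: mod_if split: if_splits)

lemma (in group) mod_chars_inv:
  assumes "\<phi> \<in> mod_chars p G" "g \<in> carrier G"
  shows "\<phi> (inv g) = (p - \<phi> g) mod p"
proof -
  have "0 = (\<phi> g + \<phi> (inv g)) mod p"
    using mod_chars_mult[OF assms(1), of g "inv g"] mod_chars_one[OF assms(1)] assms(2) by simp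
  then show ?thesis
    using mod_chars_less[OF assms] mod_chars_less[OF assms(1), of "inv g"] assms(2)
    by (auto simp: mod_if split: if_splits)
qed

lemma (in group) mod_chars_pow:
  assumes "\<phi> \<in> mod_chars p G" "g \<in> carrier G"
  shows "\<phi> (g [^] (n::nat)) = n * \<phi> g mod p"
proof (induction n)
  case 0
  then show ?case using assms by (simp add: mod_chars_one)
next
  case (Suc n)
  have "\<phi> (g [^] Suc n) = (n * \<phi> g mod p + \<phi> g) mod p"
    using assms Suc by (simp add: mod_chars_mult)
  also have "\<dots> = (n * \<phi> g + \<phi> g) mod p"
    by (rule mod_add_left_eq)
  finally show ?case by (simp add: add.commute)
qed

lemma (in group) mod_chars_eq_on_generate:
  assumes "\<phi> \<in> mod_chars p G" "\<psi> \<in> mod_chars p G" "X \<subseteq> carrier G"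
    and "\<And>x. x \<in> X \<Longrightarrow> \<phi> x = \<psi> x" and "g \<in> generate G X"
  shows "\<phi> g = \<psi> g"
  using assms(5)
proof induction
  case one
  then show ?case using assms by (simp add: mod_chars_one)
next
  case (incl h)
  then show ?case using assms by simp
next
  case (inv h)
  then show ?case using assms by (simp add: mod_chars_inv subsetD)
next
  case (eng h1 h2)
  then show ?case using assms generate_in_carrier[OF assms(3)] by (simp add: mod_chars_mult)
qed

lemma mod_chars_scale:
  assumes "\<phi> \<in> mod_chars p G" "group G" "p > 0"
  shows "(\<lambda>g\<in>carrier G. c * \<phi> g mod p) \<in> mod_chars p G"
proof -
  interpret group G by fact
  have "c * ((a + b) mod p) mod p = (c * a mod p + c * b mod p) mod p" for a b
    by (simp add: mod_mult_right_eq mod_add_eq distrib_left)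
  then show ?thesis
    using assms(1,3) by (auto simp: mod_chars_def)
qed

text \<open>All nontrivial elements have the same order, namely that of the group. If \<open>y [^] p\<close> were
  nontrivial its order would be both this and \<open>p\<close> times smaller.\<close>
lemma (in group) p_group_order_p:
  assumes p: "prime p" "order G = p ^ m" and nontriv: "y \<in> carrier G" "y \<noteq> \<one>"
    and gen: "\<And>z. z \<in> carrier G \<Longrightarrow> z \<noteq> \<one> \<Longrightarrow> generate G {z} = carrier G"
  shows "ord y = p"
proof -
  have ord: "ord z = order G" if "z \<in> carrier G" "z \<noteq> \<one>" for z
    using gen[OF that] generate_pow_card[OF that(1)] by (simp add: order_def)
  have pm: "p ^ m > 0"
    using p(1) by (simp add: prime_gt_0_nat)
  have "m \<noteq> 0"
    using ord[OF nontriv] ord_eq_1[OF nontriv(1)] nontriv(2) p(2) by (intro notI) simp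
  then have "p dvd ord y"
    using ord[OF nontriv] p(2) by simp
  then have *: "ord (y [^] p) = p ^ m div p"
    using ord_pow[OF nontriv(1), of p] ord[OF nontriv] p by (auto simp: prime_gt_0_nat)
  have "y [^] p = \<one>"
  proof (rule ccontr)
    assume "y [^] p \<noteq> \<one>"
    then have "p ^ m = p ^ m div p"
      using ord[of "y [^] p"] nontriv(1) p(2) * by simp
    moreover have "p ^ m div p < p ^ m"
      using pm prime_gt_1_nat[OF p(1)] by (rule div_less_dividend[rotated])
    ultimately show False by simp
  qed
  then have "ord y dvd p"
    using pow_eq_id[OF nontriv(1)] by simp
  moreover have "ord y \<noteq> 1"
    using ord_eq_1[OF nontriv(1)] nontriv(2) by simp
  ultimately show ?thesis
    using p(1) by (auto simp: prime_nat_iff)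
qed

text \<open>A maximal subgroup \<open>M\<close> above \<open>H\<close> is normal, and by maximality every nontrivial element generates
  the quotient by \<open>M\<close>. So the quotient is cyclic of order \<open>p\<close>, and the exponent with respect to a
  generator \<open>Y\<close> is the required homomorphism.\<close>
lemma (in group) ex_mod_char_of_p_group:
  assumes p: "prime p" "order G = p ^ m" and H: "subgroup H G" "H \<noteq> carrier G"
  shows "\<exists>\<phi>\<in>mod_chars p G. (\<forall>h\<in>H. \<phi> h = 0) \<and> (\<exists>g\<in>carrier G. \<phi> g \<noteq> 0)"
proof -
  have fin: "finite (carrier G)"
    using p by (metis order_gt_0_iff_finite prime_gt_0_nat zero_less_power)
  let ?P = "{K. subgroup K G \<and> K \<noteq> carrier G}"
  have "finite ?P"
    by (rule finite_subset[of _ "Pow (carrier G)"]) (auto simp: fin dest: subgroup.subset)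
  then obtain M where M: "subgroup M G" "M \<noteq> carrier G" "H \<subseteq> M"
    and max: "\<And>K. subgroup K G \<Longrightarrow> K \<noteq> carrier G \<Longrightarrow> M \<subseteq> K \<Longrightarrow> M = K"
    using finite_has_maximal2[of ?P H] H by auto
  have nor: "M \<lhd> G"
    using p_group_maximal_subgroup_normal[OF p M(1,2)] max by blast
  interpret M: normal M G by (rule nor)
  define F where "F = G Mod M"
  interpret F: group F
    unfolding F_def by (rule M.factorgroup_is_group)
  define \<pi> where "\<pi> = (\<lambda>g. M #> g)"
  interpret \<pi>: group_hom G F \<pi>
    unfolding \<pi>_def F_def
    by (intro group_hom.intro group_hom_axioms.intro is_group M.factorgroup_is_group M.r_coset_hom_Mod)
  have F1: "\<one>\<^bsub>F\<^esub> = M"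
    by (simp add: F_def)
  have carF: "carrier F = \<pi> ` carrier G"
    by (simp add: F_def \<pi>_def carrier_FactGroup)
  have \<pi>1: "\<pi> g = \<one>\<^bsub>F\<^esub> \<longleftrightarrow> g \<in> M" if "g \<in> carrier G" for g
    using that coset_join1[OF _ that M(1)] M.rcos_const[OF is_group] M.subset
    by (auto simp: F1 \<pi>_def)
  have gen: "generate F {Z} = carrier F" if Z: "Z \<in> carrier F" "Z \<noteq> \<one>\<^bsub>F\<^esub>" for Z
  proof -
    let ?K = "{g \<in> carrier G. \<pi> g \<in> generate F {Z}}"
    have sub: "subgroup (generate F {Z}) F"
      using F.generate_is_subgroup Z(1) by simp
    have "subgroup ?K G"
      by (rule subgroupI)
        (use sub in \<open>auto simp: subgroup.m_closed subgroup.m_inv_closed subgroup.one_closed intro: exI[of _ "\<one>"]\<close>)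
    moreover have "M \<subseteq> ?K"
    proof
      fix g assume g: "g \<in> M"
      then have "g \<in> carrier G" "\<pi> g = \<one>\<^bsub>F\<^esub>"
        using \<pi>1[of g] M.subset by auto
      then show "g \<in> ?K"
        using subgroup.one_closed[OF sub] by simp
    qed
    moreover obtain z where "z \<in> carrier G" "Z = \<pi> z"
      using Z(1) carF by blast
    then have "z \<in> ?K" "z \<notin> M"
      using Z(2) \<pi>1 by (auto intro: generate.incl)
    ultimately have "?K = carrier G"
      using max by blast
    then have "carrier F \<subseteq> generate F {Z}"
      unfolding carF by auto
    then show ?thesis
      using F.generate_incl[of "{Z}"] Z(1) by blast
  qed
  obtain y where y: "y \<in> carrier G" "y \<notin> M"
    using M(2) M.subset by blast
  define Y where "Y = \<pi> y"
  have Y: "Y \<in> carrier F" "Y \<noteq> \<one>\<^bsub>F\<^esub>"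
    using y \<pi>1 by (auto simp: Y_def)
  have "card (carrier F) * card M = p ^ m"
    using lagrange[OF M(1)] p(2) by (simp add: F_def FactGroup_def)
  then obtain e where "order F = p ^ e"
    using divides_primepow_nat[OF p(1)] by (metis dvd_triv_left order_def)
  then have ordY: "F.ord Y = p"
    using F.p_group_order_p[OF p(1) _ Y] gen by blast
  have finF: "finite (carrier F)"
    using fin carF by simp
  have inj: "a = b" if "Y [^]\<^bsub>F\<^esub> a = Y [^]\<^bsub>F\<^esub> b" "a < p" "b < p" for a b :: nat
    using F.ord_inj[OF Y(1)] that ordY by (auto simp: inj_on_def)
  have red: "Y [^]\<^bsub>F\<^esub> (a mod p) = Y [^]\<^bsub>F\<^esub> a" for a :: nat
  proof -
    have "Y [^]\<^bsub>F\<^esub> a = Y [^]\<^bsub>F\<^esub> (p * (a div p) + a mod p)"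
      by simp
    also have "\<dots> = (Y [^]\<^bsub>F\<^esub> p) [^]\<^bsub>F\<^esub> (a div p) \<otimes>\<^bsub>F\<^esub> Y [^]\<^bsub>F\<^esub> (a mod p)"
      using Y(1) by (simp only: F.nat_pow_mult[symmetric] F.nat_pow_pow)
    also have "Y [^]\<^bsub>F\<^esub> p = \<one>\<^bsub>F\<^esub>"
      using F.pow_ord_eq_1[OF Y(1)] ordY by simp
    finally show ?thesis
      using Y(1) by simp
  qed
  have ex: "\<exists>a<p. Y [^]\<^bsub>F\<^esub> a = \<pi> g" if "g \<in> carrier G" for g
  proof -
    have "\<pi> g \<in> generate F {Y}"
      using gen[OF Y] that by simp
    then obtain a :: nat where "\<pi> g = Y [^]\<^bsub>F\<^esub> a"
      using F.generate_pow_on_finite_carrier[OF finF Y(1)] by auto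
    then show ?thesis
      using red[of a] prime_gt_0_nat[OF p(1)] by (intro exI[of _ "a mod p"]) simp
  qed
  define \<phi> where "\<phi> = (\<lambda>g\<in>carrier G. THE a. a < p \<and> Y [^]\<^bsub>F\<^esub> a = \<pi> g)"
  have \<phi>: "\<phi> g < p" "Y [^]\<^bsub>F\<^esub> \<phi> g = \<pi> g" if "g \<in> carrier G" for g
  proof -
    have "\<exists>!a. a < p \<and> Y [^]\<^bsub>F\<^esub> a = \<pi> g"
      using ex[OF that] inj by metis
    from theI'[OF this] show "\<phi> g < p" "Y [^]\<^bsub>F\<^esub> \<phi> g = \<pi> g"
      using that by (simp_all add: \<phi>_def)
  qed
  have p0: "0 < p"
    by (rule prime_gt_0_nat[OF p(1)])
  have "\<phi> (g \<otimes> h) = (\<phi> g + \<phi> h) mod p" if "g \<in> carrier G" "h \<in> carrier G" for g h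
    by (rule inj) (use that \<phi> red p0 Y(1) in \<open>simp_all flip: F.nat_pow_mult\<close>)
  moreover have "\<phi> \<in> carrier G \<rightarrow>\<^sub>E {..<p}"
    using \<phi>(1) by (auto simp: \<phi>_def)
  ultimately have "\<phi> \<in> mod_chars p G"
    by (simp add: mod_chars_def)
  moreover have "\<phi> h = 0" if "h \<in> H" for h
  proof -
    have "h \<in> carrier G" "h \<in> M"
      using that M(3) M.subset by auto
    then show ?thesis
      using \<phi>[of h] \<pi>1[of h] inj[of "\<phi> h" 0] p0 by simp
  qed
  moreover have "\<phi> y \<noteq> 0"
  proof
    assume "\<phi> y = 0"
    then have "\<pi> y = \<one>\<^bsub>F\<^esub>"
      using \<phi>(2)[OF y(1)] by simp
    then show False
      using Y(2) unfolding Y_def by contradiction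
  qed
  ultimately show ?thesis
    using y(1) by blast
qed

section \<open>Counting generating tuples of a finite \<open>p\<close>-group\<close>

text \<open>The tuples \<open>g\<close> for which only the zero homomorphism into the cyclic group of order \<open>p\<close>
  kills both the entries of \<open>g\<close> and the generators \<open>x i, \<dots>, x (d - 1)\<close>. In vector space terms,
  the images of these elements together span the Frattini quotient. For \<open>i = 0\<close> every tuple
  qualifies, while for \<open>i = d\<close> the entries of \<open>g\<close> alone must do the work; the count proceeds by
  raising \<open>i\<close> one step at a time.\<close>
definition separated :: "nat \<Rightarrow> ('a, 'b) monoid_scheme \<Rightarrow> (nat \<Rightarrow> 'a) \<Rightarrow> nat \<Rightarrow> nat \<Rightarrow> nat \<Rightarrow> (nat \<Rightarrow> 'a) set" where
  "separated p G x d k i = {g \<in> {..<k} \<rightarrow>\<^sub>E carrier G. \<forall>\<phi>\<in>mod_chars p G.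
     (\<forall>l<k. \<phi> (g l) = 0) \<longrightarrow> (\<forall>j\<in>{i..<d}. \<phi> (x j) = 0) \<longrightarrow> (\<forall>h\<in>carrier G. \<phi> h = 0)}"

lemma separatedD:
  "g \<in> separated p G x d k i \<Longrightarrow> \<phi> \<in> mod_chars p G \<Longrightarrow> \<forall>l<k. \<phi> (g l) = 0 \<Longrightarrow>
     \<forall>j\<in>{i..<d}. \<phi> (x j) = 0 \<Longrightarrow> h \<in> carrier G \<Longrightarrow> \<phi> h = 0"
  by (auto simp: separated_def)

lemma (in group) separated_0:
  assumes "x \<in> {..<d} \<rightarrow> carrier G" "generate G (x ` {..<d}) = carrier G"
  shows "separated p G x d k 0 = {..<k} \<rightarrow>\<^sub>E carrier G"
proof -
  have "\<phi> h = 0" if \<phi>: "\<phi> \<in> mod_chars p G" "\<forall>j\<in>{0..<d}. \<phi> (x j) = 0" and h: "h \<in> carrier G" for \<phi> h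
  proof -
    define \<psi> where "\<psi> = (\<lambda>g\<in>carrier G. 0 * \<phi> g mod p)"
    have "p > 0"
      using mod_chars_less[OF \<phi>(1) h] by simp
    then have \<psi>: "\<psi> \<in> mod_chars p G"
      unfolding \<psi>_def by (rule mod_chars_scale[OF \<phi>(1) is_group])
    have "\<phi> h = \<psi> h"
      by (rule mod_chars_eq_on_generate[OF \<phi>(1) \<psi>, of "x ` {..<d}"])
        (use assms \<phi>(2) h in \<open>auto simp: \<psi>_def Pi_iff\<close>)
    then show ?thesis
      using h by (simp add: \<psi>_def)
  qed
  then show ?thesis
    by (auto simp: separated_def)
qed

lemma (in group) separated_generates:
  assumes "prime p" "order G = p ^ m" "g \<in> separated p G x d k d"
  shows "generate G (g ` {..<k}) = carrier G"
proof (rule ccontr)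
  assume ne: "generate G (g ` {..<k}) \<noteq> carrier G"
  have gc: "g ` {..<k} \<subseteq> carrier G"
    using assms(3) by (auto simp: separated_def)
  obtain \<phi> h where \<phi>: "\<phi> \<in> mod_chars p G" "\<forall>h\<in>generate G (g ` {..<k}). \<phi> h = 0"
    and h: "h \<in> carrier G" "\<phi> h \<noteq> 0"
    using ex_mod_char_of_p_group[OF assms(1,2) generate_is_subgroup[OF gc] ne] by blast
  have "\<forall>l<k. \<phi> (g l) = 0"
    using \<phi>(2) by (auto intro: generate.incl)
  then show False
    using assms(3) \<phi>(1) h by (auto simp: separated_def)
qed

text \<open>Such a homomorphism is determined by its values on \<open>x 0, \<dots>, x (i - 1)\<close>, the values on the
  other generators being prescribed.\<close>
lemma (in group) card_mod_chars_step:
  fixes p :: nat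
  assumes "x \<in> {..<d} \<rightarrow> carrier G" "generate G (x ` {..<d}) = carrier G" "i < d"
  defines "C \<equiv> {\<phi> \<in> mod_chars p G. \<phi> (x i) = 1 \<and> (\<forall>j\<in>{Suc i..<d}. \<phi> (x j) = 0)}"
  shows "finite C" "card C \<le> p ^ i"
proof -
  let ?r = "\<lambda>\<phi>. \<lambda>j\<in>{..<i}. \<phi> (x j)"
  have xc: "x ` {..<d} \<subseteq> carrier G" using assms(1) by auto
  have inj: "inj_on ?r C"
  proof (rule inj_onI)
    fix \<phi> \<psi> assume C: "\<phi> \<in> C" "\<psi> \<in> C" and eq: "?r \<phi> = ?r \<psi>"
    have "\<phi> (x j) = \<psi> (x j)" if "j < d" for j
    proof (cases j i rule: linorder_cases)
      case less
      then show ?thesis using fun_cong[OF eq, of j] by simp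
    qed (use C that in \<open>auto simp: C_def\<close>)
    then have "\<phi> g = \<psi> g" if "g \<in> carrier G" for g
      using mod_chars_eq_on_generate[of \<phi> p \<psi> "x ` {..<d}" g] C xc assms(2) that
      by (auto simp: C_def)
    then show "\<phi> = \<psi>"
      using C by (auto simp: C_def mod_chars_def intro: PiE_ext)
  qed
  have sub: "?r ` C \<subseteq> {..<i} \<rightarrow>\<^sub>E {..<p}"
  proof (rule image_subsetI)
    fix \<phi> assume "\<phi> \<in> C"
    then have "\<phi> \<in> mod_chars p G" by (simp add: C_def)
    then have "\<phi> (x j) < p" if "j < i" for j
      by (rule mod_chars_less) (use xc that assms(3) in auto)
    then show "?r \<phi> \<in> {..<i} \<rightarrow>\<^sub>E {..<p}" by auto
  qed
  have fin: "finite ({..<i} \<rightarrow>\<^sub>E {..<p})"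
    by (intro finite_PiE) auto
  show "finite C"
    using inj_on_finite[OF inj sub fin] .
  show "card C \<le> p ^ i"
    using card_inj_on_le[OF inj sub fin] by (simp add: card_PiE)
qed

text \<open>Multiplying the entries of \<open>g\<close> by powers of \<open>x i\<close> does not affect whether \<open>g\<close> is separated at
  stage \<open>i\<close>, because only homomorphisms that kill \<open>x i\<close> are tested there. Since \<open>\<phi>\<close> sends \<open>x i\<close>
  to \<open>1\<close>, the \<open>p ^ k\<close> translates of a tuple killed by \<open>\<phi>\<close> have distinct \<open>\<phi>\<close>-values, so the tuples
  killed by \<open>\<phi>\<close> make up at most the fraction \<open>1 / p ^ k\<close> of all.\<close>
lemma (in group) card_annihilated_le:
  assumes fin: "finite (carrier G)" and y: "x i \<in> carrier G" "i < d"
    and \<phi>: "\<phi> \<in> mod_chars p G" "\<phi> (x i) = 1"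
  shows "p ^ k * card {g \<in> separated p G x d k i. \<forall>l<k. \<phi> (g l) = 0} \<le> card (separated p G x d k i)"
proof -
  let ?E = "separated p G x d k i"
  let ?A = "{g \<in> ?E. \<forall>l<k. \<phi> (g l) = 0}"
  let ?B = "{..<k} \<rightarrow>\<^sub>E {..<p}"
  define t where "t = (\<lambda>(a, g). \<lambda>l\<in>{..<k}. x i [^] (a l :: nat) \<otimes> g l)"
  have finE: "finite ?E"
    by (rule finite_subset[of _ "{..<k} \<rightarrow>\<^sub>E carrier G"]) (auto simp: separated_def fin intro!: finite_PiE)
  have gc: "g l \<in> carrier G" if "g \<in> ?E" "l < k" for g l
    using that by (auto simp: separated_def)
  have val: "\<psi> (t (a, g) l) = (a l * \<psi> (x i) + \<psi> (g l)) mod p"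
    if "\<psi> \<in> mod_chars p G" "g \<in> ?E" "l < k" for \<psi> a g l
    using that y(1) gc[OF that(2,3)] by (simp add: t_def mod_chars_mult mod_chars_pow mod_simps)
  have "t (a, g) \<in> ?E" if g: "g \<in> ?E" for a g
  proof -
    have "\<psi> h = 0" if \<psi>: "\<psi> \<in> mod_chars p G" "\<forall>l<k. \<psi> (t (a, g) l) = 0"
      "\<forall>j\<in>{i..<d}. \<psi> (x j) = 0" and h: "h \<in> carrier G" for \<psi> h
    proof -
      have "\<psi> (x i) = 0"
        using \<psi>(3) y(2) by simp
      then have "\<psi> (g l) = 0" if "l < k" for l
        using val[OF \<psi>(1) g that, of a] \<psi>(2) that mod_chars_less[OF \<psi>(1) gc[OF g that]] by simp
      then show ?thesis
        using g \<psi>(1,3) h by (auto simp: separated_def)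
    qed
    moreover have "t (a, g) \<in> {..<k} \<rightarrow>\<^sub>E carrier G"
      using y(1) gc[OF g] by (auto simp: t_def)
    ultimately show ?thesis
      by (auto simp: separated_def)
  qed
  then have into: "t ` (?B \<times> ?A) \<subseteq> ?E"
    by auto
  have "inj_on t (?B \<times> ?A)"
  proof (rule inj_onI, clarify)
    fix a g b h
    assume a: "a \<in> ?B" and b: "b \<in> ?B" and g: "g \<in> ?E" "\<forall>l<k. \<phi> (g l) = 0"
      and h: "h \<in> ?E" "\<forall>l<k. \<phi> (h l) = 0" and eq: "t (a, g) = t (b, h)"
    have ab: "a l = b l" if "l < k" for l
    proof -
      have "a l < p" "b l < p" using a b that by auto
      then show ?thesis
        using val[OF \<phi>(1) g(1) that, of a] val[OF \<phi>(1) h(1) that, of b] eq g(2) h(2) that \<phi>(2)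
        by simp
    qed
    have "g l = h l" if "l < k" for l
      using fun_cong[OF eq, of l] that ab[OF that] y(1) gc[OF g(1) that] gc[OF h(1) that]
      by (simp add: t_def)
    then show "a = b \<and> g = h"
      using ab a b g(1) h(1) by (auto simp: separated_def intro: PiE_ext)
  qed
  then have "card (?B \<times> ?A) \<le> card ?E"
    by (rule card_inj_on_le[OF _ into finE])
  then show ?thesis
    by (simp add: card_cartesian_product card_PiE)
qed

text \<open>A tuple lost in passing from stage \<open>i\<close> to stage \<open>i + 1\<close> is killed by a homomorphism that kills
  \<open>x (i + 1), \<dots>, x (d - 1)\<close> but not \<open>x i\<close>. After rescaling, its value at \<open>x i\<close> is \<open>1\<close>. There are
  at most \<open>p ^ i\<close> such homomorphisms, each accounting for at most the fraction \<open>1 / p ^ k\<close>.\<close>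
lemma (in group) separated_step:
  assumes p: "prime p" and fin: "finite (carrier G)"
    and x: "x \<in> {..<d} \<rightarrow> carrier G" "generate G (x ` {..<d}) = carrier G" and i: "i < d" "i \<le> k"
  shows "(1 - 1 / real p ^ (k - i)) * real (card (separated p G x d k i)) \<le> real (card (separated p G x d k (Suc i)))"
proof -
  let ?E = "separated p G x d k"
  let ?C = "{\<phi> \<in> mod_chars p G. \<phi> (x i) = 1 \<and> (\<forall>j\<in>{Suc i..<d}. \<phi> (x j) = 0)}"
  let ?A = "\<lambda>\<phi>. {g \<in> ?E i. \<forall>l<k. \<phi> (g l) = 0}"
  have xi: "x i \<in> carrier G" using x(1) i by auto
  have finE: "finite (?E j)" for j
    by (rule finite_subset[of _ "{..<k} \<rightarrow>\<^sub>E carrier G"]) (auto simp: separated_def fin intro!: finite_PiE)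
  note C = card_mod_chars_step[OF x i(1), of p]
  have p0: "p > 0" using p by (rule prime_gt_0_nat)
  have cover: "?E i \<subseteq> ?E (Suc i) \<union> (\<Union>\<phi>\<in>?C. ?A \<phi>)"
  proof
    fix g assume g: "g \<in> ?E i"
    show "g \<in> ?E (Suc i) \<union> (\<Union>\<phi>\<in>?C. ?A \<phi>)"
    proof (cases "g \<in> ?E (Suc i)")
      case False
      then obtain \<phi> h where \<phi>: "\<phi> \<in> mod_chars p G" "\<forall>l<k. \<phi> (g l) = 0"
        "\<forall>j\<in>{Suc i..<d}. \<phi> (x j) = 0" and h: "h \<in> carrier G" "\<phi> h \<noteq> 0"
        using g unfolding separated_def by blast
      have "\<phi> (x i) \<noteq> 0"
      proof
        assume "\<phi> (x i) = 0"
        moreover have "j = i \<or> j \<in> {Suc i..<d}" if "j \<in> {i..<d}" for j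
          using that by auto
        ultimately have "\<forall>j\<in>{i..<d}. \<phi> (x j) = 0"
          using \<phi>(3) by blast
        then show False
          using separatedD[OF g \<phi>(1,2) _ h(1)] h(2) by simp
      qed
      moreover have "\<phi> (x i) < p"
        by (rule mod_chars_less[OF \<phi>(1) xi])
      ultimately have "coprime (\<phi> (x i)) p"
        using p by (metis coprime_commute dvd_imp_le gr0I leD prime_imp_coprime)
      then obtain c where c: "[\<phi> (x i) * c = 1] (mod p)"
        using cong_solve_coprime_nat by auto
      \<comment> \<open>Rescaling by the inverse of \<open>\<phi> (x i)\<close> normalizes the value at \<open>x i\<close> without changing the kernel.\<close>
      define \<psi> where "\<psi> = (\<lambda>g\<in>carrier G. c * \<phi> g mod p)"
      have "\<psi> \<in> mod_chars p G"
        unfolding \<psi>_def by (rule mod_chars_scale[OF \<phi>(1) is_group p0])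
      moreover have "\<psi> (x i) = 1"
        using c xi prime_gt_1_nat[OF p] by (simp add: \<psi>_def cong_def mult.commute)
      moreover have "\<forall>j\<in>{Suc i..<d}. \<psi> (x j) = 0"
        using \<phi>(3) x(1) by (auto simp: \<psi>_def Pi_iff)
      moreover have "\<forall>l<k. \<psi> (g l) = 0"
        using \<phi>(2) g by (auto simp: \<psi>_def separated_def)
      ultimately show ?thesis
        using g by blast
    qed simp
  qed
  have "card (?E i) \<le> card (?E (Suc i) \<union> (\<Union>\<phi>\<in>?C. ?A \<phi>))"
    by (rule card_mono[OF _ cover]) (use finE C(1) in auto)
  also have "\<dots> \<le> card (?E (Suc i)) + (\<Sum>\<phi>\<in>?C. card (?A \<phi>))"
    by (rule order_trans[OF card_Un_le]) (use card_UN_le[OF C(1)] in simp)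
  finally have "p ^ k * card (?E i) \<le> p ^ k * (card (?E (Suc i)) + (\<Sum>\<phi>\<in>?C. card (?A \<phi>)))"
    by simp
  also have "\<dots> = p ^ k * card (?E (Suc i)) + (\<Sum>\<phi>\<in>?C. p ^ k * card (?A \<phi>))"
    by (simp add: distrib_left sum_distrib_left)
  also have "(\<Sum>\<phi>\<in>?C. p ^ k * card (?A \<phi>)) \<le> (\<Sum>\<phi>\<in>?C. card (?E i))"
    by (intro sum_mono card_annihilated_le fin xi i) auto
  also have "\<dots> \<le> p ^ i * card (?E i)"
    using C(2) by simp
  finally have "p ^ k * card (?E i) \<le> p ^ k * card (?E (Suc i)) + p ^ i * card (?E i)"
    by simp
  then have "real (p ^ k * card (?E i)) \<le> real (p ^ k * card (?E (Suc i)) + p ^ i * card (?E i))"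
    by (rule of_nat_mono)
  moreover have "real p ^ k = real p ^ (k - i) * real p ^ i"
    using i(2) by (simp flip: power_add)
  ultimately have "real p ^ i * (real p ^ (k - i) * real (card (?E i)))
    \<le> real p ^ i * (real p ^ (k - i) * real (card (?E (Suc i))) + real (card (?E i)))"
    by (simp add: algebra_simps)
  then have "real p ^ (k - i) * real (card (?E i)) \<le> real p ^ (k - i) * real (card (?E (Suc i))) + real (card (?E i))"
    by (rule mult_left_le_imp_le) (use p0 in simp)
  then show ?thesis
    using p0 by (simp add: field_simps)
qed

text \<open>The bound is an equality when \<open>d\<close> is the minimal number of generators: then it is the proportion
  of \<open>k\<close>-tuples that span a vector space of dimension \<open>d\<close> over the field with \<open>p\<close> elements.\<close>
theorem (in group) p_group_card_generating_tuples:
  assumes p: "prime p" "order G = p ^ m"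
    and x: "x \<in> {..<d} \<rightarrow> carrier G" "generate G (x ` {..<d}) = carrier G" and k: "d \<le> k"
  shows "(\<Prod>j<d. 1 - 1 / real p ^ (k - j)) * real (order G) ^ k
    \<le> real (card {g \<in> {..<k} \<rightarrow>\<^sub>E carrier G. generate G (g ` {..<k}) = carrier G})"
proof -
  have fin: "finite (carrier G)"
    using p by (metis order_gt_0_iff_finite prime_gt_0_nat zero_less_power)
  have fac: "0 \<le> 1 - 1 / real p ^ n" for n
    using prime_ge_1_nat[OF p(1)] by simp
  have "(\<Prod>j<i. 1 - 1 / real p ^ (k - j)) * real (order G) ^ k \<le> real (card (separated p G x d k i))"
    if "i \<le> d" for i
    using that
  proof (induction i)
    case 0
    then show ?case
      by (simp add: separated_0[OF x] card_PiE order_def)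
  next
    case (Suc i)
    have "(\<Prod>j<Suc i. 1 - 1 / real p ^ (k - j)) * real (order G) ^ k
      = (1 - 1 / real p ^ (k - i)) * ((\<Prod>j<i. 1 - 1 / real p ^ (k - j)) * real (order G) ^ k)"
      by simp
    also have "\<dots> \<le> (1 - 1 / real p ^ (k - i)) * real (card (separated p G x d k i))"
      by (intro mult_left_mono fac) (use Suc in simp)
    also have "\<dots> \<le> real (card (separated p G x d k (Suc i)))"
      by (rule separated_step[OF p(1) fin x]) (use Suc.prems k in auto)
    finally show ?case .
  qed
  from this[of d] have "(\<Prod>j<d. 1 - 1 / real p ^ (k - j)) * real (order G) ^ k \<le> real (card (separated p G x d k d))"
    by simp
  also have "separated p G x d k d \<subseteq> {g \<in> {..<k} \<rightarrow>\<^sub>E carrier G. generate G (g ` {..<k}) = carrier G}"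
    using separated_generates[OF p] by (auto simp: separated_def)
  then have "card (separated p G x d k d) \<le> card {g \<in> {..<k} \<rightarrow>\<^sub>E carrier G. generate G (g ` {..<k}) = carrier G}"
    by (rule card_mono[rotated]) (rule finite_subset[of _ "{..<k} \<rightarrow>\<^sub>E carrier G"], auto simp: fin intro!: finite_PiE)
  finally show ?thesis
    by simp
qed

section \<open>Translation-invariant measures and finite quotients\<close>

text \<open>Only the cosets of one normal subgroup \<open>N\<close> of finite index are ever measured, so all that is
  retained from Haar measure is that they are measurable and that translation preserves the
  measure of \<open>N\<close>. The product measure then induces the uniform distribution on the \<open>k\<close>-tuples of
  the quotient.\<close>
locale invariant_on_cosets = normal N A + M: prob_space M
  for N :: "'a set" and A :: "('a, 'b) monoid_scheme" (structure) and M :: "'a measure" +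
  assumes space_eq: "space M = carrier A"
    and finite_index: "finite (rcosets N)"
    and coset_in_sets: "C \<in> rcosets N \<Longrightarrow> C \<in> sets M"
    and translate: "g \<in> carrier A \<Longrightarrow> emeasure M (g <# N) = emeasure M N"
begin

lemma measure_coset:
  assumes "C \<in> rcosets N"
  shows "measure M C = 1 / real (card (rcosets N))"
proof -
  have eq: "measure M D = measure M N" if D: "D \<in> rcosets N" for D
  proof -
    obtain g where "g \<in> carrier A" "D = N #> g"
      using D by (auto simp: RCOSETS_def)
    then have "D = g <# N"
      using coset_eq by blast
    then show ?thesis
      using translate[OF \<open>g \<in> carrier A\<close>] by (simp add: measure_def)
  qed
  have "1 = measure M (\<Union>D\<in>rcosets N. D)"
    using M.prob_space rcosets_part_G[OF subgroup_axioms] by (simp add: space_eq)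
  also have "\<dots> = (\<Sum>D\<in>rcosets N. measure M D)"
    using coset_in_sets rcos_disjoint[OF subgroup_axioms]
    by (intro M.finite_measure_finite_Union finite_index)
      (auto simp: disjoint_family_on_def pairwise_def disjnt_def)
  also have "\<dots> = real (card (rcosets N)) * measure M N"
    by (simp add: eq)
  finally have *: "1 = real (card (rcosets N)) * measure M N" .
  then have "real (card (rcosets N)) \<noteq> 0"
    by (metis mult_zero_left zero_neq_one)
  moreover have "measure M N * real (card (rcosets N)) = 1"
    using * by (simp only: mult.commute)
  ultimately have "measure M N = 1 / real (card (rcosets N))"
    by (rule eq_divide_imp)
  then show ?thesis
    by (simp only: eq[OF assms])
qed

definition coset_tuple :: "nat \<Rightarrow> (nat \<Rightarrow> 'a) \<Rightarrow> nat \<Rightarrow> 'a set" where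
  "coset_tuple k g = (\<lambda>l\<in>{..<k}. N #> g l)"

definition tuples_over :: "nat \<Rightarrow> (nat \<Rightarrow> 'a set) set \<Rightarrow> (nat \<Rightarrow> 'a) set" where
  "tuples_over k S = {g \<in> {..<k} \<rightarrow>\<^sub>E carrier A. coset_tuple k g \<in> S}"


lemma coset_eq_iff:
  assumes "g \<in> carrier A" "C \<in> rcosets N"
  shows "N #> g = C \<longleftrightarrow> g \<in> C"
proof
  assume "g \<in> C"
  moreover obtain h where "h \<in> carrier A" "C = N #> h"
    using assms(2) by (auto simp: RCOSETS_def)
  ultimately show "N #> g = C"
    using repr_independence[OF _ _ subgroup_axioms] by metis
qed (use rcos_self[OF assms(1) subgroup_axioms] in blast)

lemma tuples_over_eq_UN:
  assumes "S \<subseteq> {..<k} \<rightarrow>\<^sub>E rcosets N"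
  shows "tuples_over k S = (\<Union>q\<in>S. PiE {..<k} q)"
proof (intro Set.set_eqI iffI)
  fix g assume "g \<in> tuples_over k S"
  then have g: "g \<in> {..<k} \<rightarrow>\<^sub>E carrier A" "coset_tuple k g \<in> S"
    by (auto simp: tuples_over_def)
  moreover have "g \<in> PiE {..<k} (coset_tuple k g)"
    using g(1) rcos_self[OF _ subgroup_axioms] by (auto simp: coset_tuple_def PiE_iff)
  ultimately show "g \<in> (\<Union>q\<in>S. PiE {..<k} q)"
    by blast
next
  fix g assume "g \<in> (\<Union>q\<in>S. PiE {..<k} q)"
  then obtain q where q: "q \<in> S" "g \<in> PiE {..<k} q" by blast
  have qr: "q \<in> {..<k} \<rightarrow>\<^sub>E rcosets N"
    using q(1) assms by blast
  have gc: "g l \<in> carrier A" if "l < k" for l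
  proof -
    have "q l \<in> rcosets N" "g l \<in> q l"
      using qr q(2) that by auto
    then show ?thesis
      using rcosets_carrier by blast
  qed
  have "coset_tuple k g = q"
  proof (rule ext)
    fix l
    show "coset_tuple k g l = q l"
    proof (cases "l < k")
      case True
      then have "q l \<in> rcosets N" "g l \<in> q l"
        using qr q(2) by auto
      then show ?thesis
        using coset_eq_iff[OF gc[OF True]] True by (simp add: coset_tuple_def)
    next
      case False
      then show ?thesis
        using PiE_arb[OF qr, of l] by (simp add: coset_tuple_def)
    qed
  qed
  moreover have "g \<in> {..<k} \<rightarrow>\<^sub>E carrier A"
    using q(2) gc by (simp add: PiE_iff)
  ultimately show "g \<in> tuples_over k S"
    using q(1) by (simp add: tuples_over_def)
qed

lemma tuples_over_sets:
  assumes "S \<subseteq> {..<k} \<rightarrow>\<^sub>E rcosets N"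
  shows "tuples_over k S \<in> sets (Pi\<^sub>M {..<k} (\<lambda>_. M))"
proof -
  have "finite S"
    using assms by (rule finite_subset) (intro finite_PiE finite_lessThan finite_index)
  moreover have "PiE {..<k} q \<in> sets (Pi\<^sub>M {..<k} (\<lambda>_. M))" if "q \<in> S" for q
    by (rule sets_PiM_I_finite) (use that assms coset_in_sets in auto)
  ultimately show ?thesis
    unfolding tuples_over_eq_UN[OF assms] by blast
qed

lemma measure_tuples_over:
  assumes "S \<subseteq> {..<k} \<rightarrow>\<^sub>E rcosets N"
  shows "measure (Pi\<^sub>M {..<k} (\<lambda>_. M)) (tuples_over k S) = real (card S) / real (card (rcosets N)) ^ k"
proof -
  interpret P: product_prob_space "\<lambda>_. M" "{..<k}"
    by unfold_locales
  have fin: "finite S"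
    using assms by (rule finite_subset) (intro finite_PiE finite_lessThan finite_index)
  have q: "q l \<in> rcosets N" if "q \<in> S" "l < k" for q l
    using that assms by auto
  have "disjoint_family_on (PiE {..<k}) S"
    unfolding disjoint_family_on_def
  proof (intro ballI impI)
    fix q r assume qr: "q \<in> S" "r \<in> S" "q \<noteq> r"
    then obtain l where l: "l < k" "q l \<noteq> r l"
      using PiE_ext[of q "{..<k}" "\<lambda>_. rcosets N" r] assms by blast
    then have "q l \<inter> r l = {}"
      using rcos_disjoint[OF subgroup_axioms] q qr by (auto simp: pairwise_def disjnt_def)
    then show "PiE {..<k} q \<inter> PiE {..<k} r = {}"
      using l(1) by (auto simp: PiE_iff)
  qed
  then have "measure (Pi\<^sub>M {..<k} (\<lambda>_. M)) (tuples_over k S) = (\<Sum>q\<in>S. measure (Pi\<^sub>M {..<k} (\<lambda>_. M)) (PiE {..<k} q))"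
    unfolding tuples_over_eq_UN[OF assms]
    by (intro P.P.finite_measure_finite_Union fin) (use q coset_in_sets in \<open>auto intro!: sets_PiM_I_finite\<close>)
  also have "\<dots> = (\<Sum>q\<in>S. (1 / real (card (rcosets N))) ^ k)"
  proof (rule sum.cong[OF refl])
    fix r assume r: "r \<in> S"
    have "emeasure (Pi\<^sub>M {..<k} (\<lambda>_. M)) (PiE {..<k} r) = (\<Prod>l<k. emeasure M (r l))"
      by (rule P.emeasure_PiM) (use q[OF r] coset_in_sets in auto)
    also have "\<dots> = (\<Prod>l<k. ennreal (1 / real (card (rcosets N))))"
      by (rule prod.cong) (use q[OF r] measure_coset in \<open>auto simp: M.emeasure_eq_measure\<close>)
    also have "\<dots> = ennreal ((1 / real (card (rcosets N))) ^ k)"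
      by (simp add: ennreal_power)
    finally show "measure (Pi\<^sub>M {..<k} (\<lambda>_. M)) (PiE {..<k} r) = (1 / real (card (rcosets N))) ^ k"
      by (simp add: measure_def)
  qed
  finally show ?thesis
    by (simp add: power_one_over divide_inverse power_inverse)
qed

text \<open>An event is measurable as soon as it depends only on the cosets of the entries: it is then a finite
  union of boxes.\<close>
lemma saturated_sets:
  assumes "S \<subseteq> {..<k} \<rightarrow>\<^sub>E carrier A"
    and "\<And>g h. g \<in> S \<Longrightarrow> h \<in> {..<k} \<rightarrow>\<^sub>E carrier A \<Longrightarrow> coset_tuple k g = coset_tuple k h \<Longrightarrow> h \<in> S"
  shows "S \<in> sets (Pi\<^sub>M {..<k} (\<lambda>_. M))"
proof -
  have "coset_tuple k ` S \<subseteq> {..<k} \<rightarrow>\<^sub>E rcosets N"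
  proof (rule image_subsetI)
    fix g assume "g \<in> S"
    then have "g l \<in> carrier A" if "l < k" for l
      using assms(1) that by auto
    then show "coset_tuple k g \<in> {..<k} \<rightarrow>\<^sub>E rcosets N"
      using rcosetsI[OF subset] by (auto simp: coset_tuple_def)
  qed
  moreover have "S = tuples_over k (coset_tuple k ` S)"
  proof (intro Set.set_eqI iffI)
    fix h assume "h \<in> tuples_over k (coset_tuple k ` S)"
    then obtain g where "g \<in> S" "h \<in> {..<k} \<rightarrow>\<^sub>E carrier A" "coset_tuple k g = coset_tuple k h"
      unfolding tuples_over_def by force
    then show "h \<in> S"
      by (rule assms(2))
  qed (use assms(1) in \<open>auto simp: tuples_over_def\<close>)
  ultimately show ?thesis
    using tuples_over_sets by metis
qed

end

section \<open>Level stabilizers and restriction to finite levels\<close>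

lemma mult_AutT_apply: "v \<in> tree p \<Longrightarrow> (g \<otimes>\<^bsub>AutT p\<^esub> h) v = h (g v)"
  by (simp add: mult_AutT compose_eq)

lemma inv_AutT_apply:
  assumes "g \<in> carrier (AutT p)" "v \<in> tree p"
  shows "(inv\<^bsub>AutT p\<^esub> g) (g v) = v"
proof -
  interpret group "AutT p" by (rule group_AutT)
  have "(g \<otimes>\<^bsub>AutT p\<^esub> inv\<^bsub>AutT p\<^esub> g) v = v"
    using assms by (simp add: one_AutT)
  then show ?thesis
    using assms(2) by (simp add: mult_AutT_apply)
qed

lemma AutT_maps_level: "g \<in> carrier (AutT p) \<Longrightarrow> v \<in> level p n \<Longrightarrow> g v \<in> level p n"
  by (simp add: level_def AutT_closed length_AutT)

lemma level_in_tree: "v \<in> level p n \<Longrightarrow> v \<in> tree p"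
  by (simp add: level_def)

lemma St_normal: "St p n \<lhd> AutT p"
proof -
  interpret group "AutT p" by (rule group_AutT)
  have fix_inv: "(inv\<^bsub>AutT p\<^esub> g) v = v" if "g \<in> carrier (AutT p)" "v \<in> tree p" "g v = v" for g v
    using inv_AutT_apply[OF that(1,2)] that(3) by simp
  have "subgroup (St p n) (AutT p)"
  proof (rule subgroupI)
    show "St p n \<noteq> {}"
      using one_closed by (auto simp: St_def one_AutT level_def)
  qed (auto simp: St_def mult_AutT_apply level_in_tree fix_inv)
  then show ?thesis
    unfolding normal_inv_iff
    by (auto simp: St_def mult_AutT_apply level_in_tree AutT_maps_level inv_AutT_apply AutT_closed)
qed

lemma St_fixes_upper_levels:
  assumes "s \<in> St p n" "v \<in> tree p" "length v \<le> n"
  shows "s v = v"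
proof (cases "n = 0")
  case True
  then show ?thesis
    using assms by (simp add: St_def carrier_AutT_iff)
next
  case False
  then have "s \<in> St p (length v)"
    using St_antimono[of "length v" n p] assms by auto
  then show ?thesis
    using assms(2) by (simp add: St_def level_def)
qed

text \<open>This identifies the image of \<^const>\<open>proj\<close> with the quotient by the level stabilizer, and
  permits working with cosets in place of restrictions to a finite tree.\<close>
lemma proj_eq_iff_St:
  assumes g: "g \<in> carrier (AutT p)" and h: "h \<in> carrier (AutT p)"
  shows "proj p n g = proj p n h \<longleftrightarrow> g \<otimes>\<^bsub>AutT p\<^esub> inv\<^bsub>AutT p\<^esub> h \<in> St p n"
proof -
  interpret group "AutT p" by (rule group_AutT)
  let ?s = "g \<otimes>\<^bsub>AutT p\<^esub> inv\<^bsub>AutT p\<^esub> h"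
  have s: "?s \<in> carrier (AutT p)" and g_eq: "g = ?s \<otimes>\<^bsub>AutT p\<^esub> h"
    using g h by (simp_all add: m_assoc)
  show ?thesis
  proof
    assume eq: "proj p n g = proj p n h"
    have "?s v = v" if v: "v \<in> level p n" for v
    proof -
      have "g v = h v"
        using fun_cong[OF eq, of v] v by (simp add: proj_def level_def)
      then show ?thesis
        using v h by (simp add: mult_AutT_apply level_in_tree inv_AutT_apply)
    qed
    then show "?s \<in> St p n"
      using s by (simp add: St_def)
  next
    assume st: "?s \<in> St p n"
    have "g v = h v" if "v \<in> tree p" "length v \<le> n" for v
      using mult_AutT_apply[OF that(1), of ?s h] St_fixes_upper_levels[OF st that] g_eq by simp
    then show "proj p n g = proj p n h"
      by (auto simp: proj_def restrict_def)
  qed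
qed

lemma proj_proj: "m \<le> n \<Longrightarrow> proj p m g = restrict (proj p n g) {v \<in> tree p. length v \<le> m}"
  by (auto simp: proj_def restrict_def)

lemma openin_proj_fibre: "openin (cong_top p) {h \<in> carrier (AutT p). proj p n h = proj p n g}"
  unfolding openin_cong_top
proof (intro conjI ballI)
  fix h assume h: "h \<in> {h \<in> carrier (AutT p). proj p n h = proj p n g}"
  interpret group "AutT p" by (rule group_AutT)
  have "h \<otimes>\<^bsub>AutT p\<^esub> s \<in> {h \<in> carrier (AutT p). proj p n h = proj p n g}" if s: "s \<in> St p (Suc n)" for s
  proof -
    have "(h \<otimes>\<^bsub>AutT p\<^esub> s) v = h v" if v: "v \<in> tree p" "length v \<le> n" for v
    proof -
      have "s (h v) = h v"
        by (rule St_fixes_upper_levels[OF s]) (use h v in \<open>auto simp: AutT_closed length_AutT\<close>)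
      then show ?thesis
        using v by (simp add: mult_AutT_apply)
    qed
    then have "proj p n (h \<otimes>\<^bsub>AutT p\<^esub> s) = proj p n h"
      unfolding proj_def by (intro restrict_ext) blast
    then show ?thesis
      using h s by (simp add: St_def)
  qed
  then show "\<exists>m\<ge>1. h <#\<^bsub>AutT p\<^esub> St p m \<subseteq> {h \<in> carrier (AutT p). proj p n h = proj p n g}"
    by (intro exI[of _ "Suc n"]) (auto simp: l_coset_def)
qed auto

text \<open>Used to pass between \<^const>\<open>proj\<close> and the coset map, which have the same fibres.\<close>
lemma image_eq_iff_of_same_fibres:
  assumes "\<And>a b. a \<in> A \<Longrightarrow> b \<in> A \<Longrightarrow> f a = f b \<longleftrightarrow> g a = g b" "S \<subseteq> A" "T \<subseteq> A"
  shows "f ` S = f ` T \<longleftrightarrow> g ` S = g ` T"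
proof -
  have "f ` S \<subseteq> f ` T \<longleftrightarrow> g ` S \<subseteq> g ` T" if "S \<subseteq> A" "T \<subseteq> A" for S T
  proof -
    have "f s \<in> f ` T \<longleftrightarrow> g s \<in> g ` T" if s: "s \<in> S" for s
      using assms(1) \<open>S \<subseteq> A\<close> \<open>T \<subseteq> A\<close> s unfolding image_iff by blast
    then show ?thesis by (simp add: image_subset_iff)
  qed
  then show ?thesis
    using assms(2,3) by (simp add: set_eq_subset)
qed

section \<open>Random subgroups\<close>

locale haar_pro_group =
  fixes p :: nat and G :: "(nat list \<Rightarrow> nat list) set" and \<mu> :: "(nat list \<Rightarrow> nat list) measure"
  assumes p: "prime p" and pro: "pro_subgroup p p G" and haar: "normalized_haar_measure p G \<mu>"
begin

sublocale AutT: group "AutT p" by (rule group_AutT)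

abbreviation "A \<equiv> (AutT p)\<lparr>carrier := G\<rparr>"
abbreviation "N n \<equiv> St p n \<inter> G"

lemma G: "subgroup G (AutT p)"
  using pro by (simp add: pro_subgroup_def)

lemma Gc: "G \<subseteq> carrier (AutT p)"
  by (rule subgroup.subset[OF G])

sublocale A: group A
  by (rule AutT.subgroup_imp_group[OF G])

lemma N_normal: "N n \<lhd> A"
  by (rule AutT.normal_Int_subgroup[OF G St_normal])

(* This rule would rewrite cosets in A to cosets in the ambient group, to which
   the facts about normal subgroups of A no longer apply. *)
declare r_coset_consistent [simp del]

lemma coset_eq_fibre:
  assumes g: "g \<in> G"
  shows "N n #>\<^bsub>A\<^esub> g = {h \<in> G. proj p n h = proj p n g}"
proof -
  have sub: "subgroup (N n) A" by (rule normal_imp_subgroup[OF N_normal])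
  have "h \<in> N n #>\<^bsub>A\<^esub> g \<longleftrightarrow> proj p n h = proj p n g" if h: "h \<in> G" for h
  proof -
    have "h \<in> N n #>\<^bsub>A\<^esub> g \<longleftrightarrow> h \<otimes>\<^bsub>AutT p\<^esub> inv\<^bsub>AutT p\<^esub> g \<in> N n"
      using subgroup.rcos_module[OF sub A.is_group, of g h] g h
      by (simp add: AutT.m_inv_consistent[OF G])
    also have "\<dots> \<longleftrightarrow> h \<otimes>\<^bsub>AutT p\<^esub> inv\<^bsub>AutT p\<^esub> g \<in> St p n"
      using g h G by (simp add: subgroup.m_closed subgroup.m_inv_closed)
    also have "\<dots> \<longleftrightarrow> proj p n h = proj p n g"
      using proj_eq_iff_St[of h p g n] g h Gc by auto
    finally show ?thesis .
  qed
  moreover have "N n #>\<^bsub>A\<^esub> g \<subseteq> G"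
    using A.r_coset_subset_G[of "N n" g] g by simp
  ultimately show ?thesis by blast
qed

lemma coset_eq_iff_proj:
  "g \<in> G \<Longrightarrow> h \<in> G \<Longrightarrow> N n #>\<^bsub>A\<^esub> g = N n #>\<^bsub>A\<^esub> h \<longleftrightarrow> proj p n g = proj p n h"
  by (auto simp: coset_eq_fibre)

lemma openin_coset: "C \<in> rcosets\<^bsub>A\<^esub> N n \<Longrightarrow> openin (subtopology (cong_top p) G) C"
proof -
  assume "C \<in> rcosets\<^bsub>A\<^esub> N n"
  then obtain g where "g \<in> G" "C = N n #>\<^bsub>A\<^esub> g"
    by (auto simp: RCOSETS_def)
  then have "C = {h \<in> carrier (AutT p). proj p n h = proj p n g} \<inter> G"
    using Gc by (auto simp: coset_eq_fibre)
  then show ?thesis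
    unfolding openin_subtopology using openin_proj_fibre by blast
qed

lemma card_cosets: "\<exists>m. card (rcosets\<^bsub>A\<^esub> N n) = p ^ m"
proof -
  have "N n \<in> rcosets\<^bsub>A\<^esub> N n"
    by (rule subgroup.subgroup_in_rcosets[OF normal_imp_subgroup[OF N_normal] A.is_group])
  then show ?thesis
    using pro N_normal openin_coset unfolding pro_subgroup_def by blast
qed

lemma coset_in_sets: "C \<in> rcosets\<^bsub>A\<^esub> N n \<Longrightarrow> C \<in> sets \<mu>"
  using haar openin_coset unfolding normalized_haar_measure_def by (auto intro: sigma_sets.Basic)

lemma prob_space_\<mu>: "prob_space \<mu>"
  using haar by (intro prob_spaceI) (simp add: normalized_haar_measure_def)

lemma space_\<mu>: "space \<mu> = G"
  using haar by (simp add: normalized_haar_measure_def)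

lemma invariant: "invariant_on_cosets (N n) A \<mu>"
proof (intro invariant_on_cosets.intro invariant_on_cosets_axioms.intro N_normal prob_space_\<mu>)
  show "space \<mu> = carrier A"
    by (simp add: space_\<mu>)
  show "finite (rcosets\<^bsub>A\<^esub> N n)"
    using card_cosets[of n] prime_gt_0_nat[OF p] by (intro card_ge_0_finite) auto
  show "C \<in> sets \<mu>" if "C \<in> rcosets\<^bsub>A\<^esub> N n" for C
    using that by (rule coset_in_sets)
  show "emeasure \<mu> (g <#\<^bsub>A\<^esub> N n) = emeasure \<mu> (N n)" if "g \<in> carrier A" for g
  proof -
    have "N n \<in> sets \<mu>"
      by (rule coset_in_sets[OF subgroup.subgroup_in_rcosets[OF normal_imp_subgroup[OF N_normal] A.is_group]])
    then show ?thesis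
      using haar that by (simp add: normalized_haar_measure_def)
  qed
qed

abbreviation gen :: "nat \<Rightarrow> (nat \<Rightarrow> nat list \<Rightarrow> nat list) \<Rightarrow> (nat list \<Rightarrow> nat list) set" where
  "gen k g \<equiv> generate (AutT p) (g ` {..<k})"

lemma gen_subset: "g \<in> {..<k} \<rightarrow> G \<Longrightarrow> gen k g \<subseteq> G"
  by (rule AutT.generate_subgroup_incl[OF _ G]) auto

lemma generate_quotient:
  assumes "g \<in> {..<k} \<rightarrow> G"
  shows "generate (A Mod N n) ((\<lambda>l. N n #>\<^bsub>A\<^esub> g l) ` {..<k}) = (\<lambda>h. N n #>\<^bsub>A\<^esub> h) ` gen k g"
proof -
  interpret normal "N n" A by (rule N_normal)
  interpret \<pi>: group_hom A "A Mod N n" "\<lambda>h. N n #>\<^bsub>A\<^esub> h"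
    by (intro group_hom.intro group_hom_axioms.intro A.is_group factorgroup_is_group r_coset_hom_Mod)
  have gG: "g ` {..<k} \<subseteq> G" using assms by auto
  have "generate (A Mod N n) ((\<lambda>h. N n #>\<^bsub>A\<^esub> h) ` (g ` {..<k})) = (\<lambda>h. N n #>\<^bsub>A\<^esub> h) ` generate A (g ` {..<k})"
    by (rule \<pi>.generate_img) (use gG in simp)
  then show ?thesis
    by (simp add: image_image AutT.generate_consistent[OF gG G])
qed

text \<open>The probability that a random tuple generates \<open>G\<close> as far as level \<open>n\<close> can see is a proportion of
  generating tuples in the finite \<open>p\<close>-group \<open>A Mod N n\<close>, which \<open>d\<close> elements generate because the
  given \<open>d\<close> elements of \<open>G\<close> generate a dense subgroup.\<close>
lemma measure_generates_level:
  fixes n :: nat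
  assumes top: "topologically_generated p d G" and k: "d \<le> k"
  defines "E \<equiv> {g \<in> {..<k} \<rightarrow>\<^sub>E G. proj p n ` gen k g = proj p n ` G}"
  shows "E \<in> sets (Pi\<^sub>M {..<k} (\<lambda>_. \<mu>))"
    and "(\<Prod>j<d. 1 - 1 / real p ^ (k - j)) \<le> measure (Pi\<^sub>M {..<k} (\<lambda>_. \<mu>)) E"
proof -
  interpret I: invariant_on_cosets "N n" A \<mu> by (rule invariant)
  define Q where "Q = A Mod N n"
  interpret Q: group Q unfolding Q_def by (rule I.factorgroup_is_group)
  have carQ: "carrier Q = rcosets\<^bsub>A\<^esub> N n"
    by (simp add: Q_def FactGroup_def)
  have carQ': "carrier Q = (\<lambda>h. N n #>\<^bsub>A\<^esub> h) ` G"
    by (simp add: Q_def carrier_FactGroup)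
  have same: "N n #>\<^bsub>A\<^esub> a = N n #>\<^bsub>A\<^esub> b \<longleftrightarrow> proj p n a = proj p n b" if "a \<in> G" "b \<in> G" for a b
    by (rule coset_eq_iff_proj[OF that])
  have gen_iff: "generate Q ((\<lambda>l. N n #>\<^bsub>A\<^esub> g l) ` {..<j}) = carrier Q \<longleftrightarrow> proj p n ` gen j g = proj p n ` G"
    if "g \<in> {..<j} \<rightarrow> G" for g j
    unfolding carQ' unfolding Q_def generate_quotient[OF that]
    by (rule image_eq_iff_of_same_fibres[OF same gen_subset[OF that]]) auto
  let ?S = "{q \<in> {..<k} \<rightarrow>\<^sub>E carrier Q. generate Q (q ` {..<k}) = carrier Q}"
  have S: "?S \<subseteq> {..<k} \<rightarrow>\<^sub>E rcosets\<^bsub>A\<^esub> N n"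
    unfolding carQ by blast
  have E: "E = I.tuples_over k ?S"
  proof -
    have "proj p n ` gen k g = proj p n ` G \<longleftrightarrow> I.coset_tuple k g \<in> ?S" if g: "g \<in> {..<k} \<rightarrow>\<^sub>E G" for g
    proof -
      have "I.coset_tuple k g \<in> {..<k} \<rightarrow>\<^sub>E carrier Q"
        using g by (auto simp: I.coset_tuple_def carQ')
      moreover have "I.coset_tuple k g ` {..<k} = (\<lambda>l. N n #>\<^bsub>A\<^esub> g l) ` {..<k}"
        by (simp add: I.coset_tuple_def)
      moreover have "g \<in> {..<k} \<rightarrow> G" using g by auto
      ultimately show ?thesis
        using gen_iff[of g k] by simp
    qed
    then show ?thesis
      unfolding E_def I.tuples_over_def by (intro Collect_cong conj_cong) simp_all
  qed
  show "E \<in> sets (Pi\<^sub>M {..<k} (\<lambda>_. \<mu>))"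
    unfolding E by (rule I.tuples_over_sets[OF S])
  obtain x where x: "x \<in> {..<d} \<rightarrow> G" and cl: "(subtopology (cong_top p) G) closure_of (gen d x) = G"
    using top by (auto simp: topologically_generated_def)
  have dense: "\<exists>h\<in>gen d x. proj p n g = proj p n h" if g: "g \<in> G" for g
  proof -
    have "g \<in> (subtopology (cong_top p) G) closure_of (gen d x)"
      using cl g by simp
    moreover have "openin (subtopology (cong_top p) G) (N n #>\<^bsub>A\<^esub> g)"
      by (rule openin_coset) (use g in \<open>auto simp: RCOSETS_def\<close>)
    moreover have "g \<in> N n #>\<^bsub>A\<^esub> g"
      using g by (simp add: coset_eq_fibre)
    ultimately obtain h where "h \<in> gen d x" "h \<in> N n #>\<^bsub>A\<^esub> g"
      unfolding in_closure_of by blast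
    then show ?thesis
      using g by (auto simp: coset_eq_fibre intro: sym)
  qed
  have "proj p n ` G \<subseteq> proj p n ` gen d x"
    unfolding image_subset_iff image_iff using dense by blast
  then have "proj p n ` gen d x = proj p n ` G"
    using gen_subset[OF x] by blast
  then have xgen: "generate Q ((\<lambda>l. N n #>\<^bsub>A\<^esub> x l) ` {..<d}) = carrier Q"
    using gen_iff[OF x] by simp
  obtain m where m: "order Q = p ^ m"
    using card_cosets[of n] by (auto simp: order_def carQ)
  have "(\<Prod>j<d. 1 - 1 / real p ^ (k - j)) * real (order Q) ^ k \<le> real (card ?S)"
    by (rule Q.p_group_card_generating_tuples[OF p m _ xgen k]) (use x in \<open>auto simp: carQ'\<close>)
  moreover have "order Q = card (rcosets\<^bsub>A\<^esub> N n)"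
    by (simp add: order_def carQ)
  moreover have "real (order Q) ^ k > 0"
    using m prime_gt_0_nat[OF p] by simp
  ultimately show "(\<Prod>j<d. 1 - 1 / real p ^ (k - j)) \<le> measure (Pi\<^sub>M {..<k} (\<lambda>_. \<mu>)) E"
    unfolding E I.measure_tuples_over[OF S] by (simp add: pos_le_divide_eq)
qed

lemma prob_space_PiM_\<mu>: "prob_space (Pi\<^sub>M {..<k::nat} (\<lambda>_. \<mu>))"
  by (rule prob_space_PiM) (rule prob_space_\<mu>)

lemma space_PiM_\<mu>: "space (Pi\<^sub>M {..<k::nat} (\<lambda>_. \<mu>)) = {..<k} \<rightarrow>\<^sub>E G"
  by (simp add: space_PiM space_\<mu>)

text \<open>Without measurability the probability in question would be \<open>0\<close> by convention. Each term of the
  sequence whose limit is \<^const>\<open>FPP\<close> depends only on the cosets of the entries modulo \<open>N n\<close>, and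
  the limit of a sequence of measurable real functions is measurable, whether or not it converges
  everywhere.\<close>
lemma FPP_gen_measurable: "(\<lambda>g. FPP p (gen k g)) \<in> borel_measurable (Pi\<^sub>M {..<k} (\<lambda>_. \<mu>))"
  unfolding FPP_def
proof (rule borel_measurable_lim_metric)
  fix n
  interpret I: invariant_on_cosets "N n" A \<mu> by (rule invariant)
  let ?r = "\<lambda>P. real (card {h \<in> P. \<exists>v\<in>level p n. h v = v}) / real (card P)"
  have proj_gen: "proj p n ` gen k g = proj p n ` gen k h"
    if "g \<in> {..<k} \<rightarrow>\<^sub>E G" "h \<in> {..<k} \<rightarrow>\<^sub>E G" and eq: "I.coset_tuple k g = I.coset_tuple k h" for g h
  proof -
    have g: "g \<in> {..<k} \<rightarrow> G" and h: "h \<in> {..<k} \<rightarrow> G"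
      using that by auto
    have "(\<lambda>l. N n #>\<^bsub>A\<^esub> g l) ` {..<k} = (\<lambda>l. N n #>\<^bsub>A\<^esub> h l) ` {..<k}"
    proof (rule image_cong[OF refl])
      fix l assume "l \<in> {..<k}"
      then show "N n #>\<^bsub>A\<^esub> g l = N n #>\<^bsub>A\<^esub> h l"
        using fun_cong[OF eq, of l] by (simp add: I.coset_tuple_def)
    qed
    then have "(\<lambda>h. N n #>\<^bsub>A\<^esub> h) ` gen k g = (\<lambda>h. N n #>\<^bsub>A\<^esub> h) ` gen k h"
      using generate_quotient[OF g, of n] generate_quotient[OF h, of n] by simp
    then show ?thesis
      using image_eq_iff_of_same_fibres[of G "\<lambda>h. N n #>\<^bsub>A\<^esub> h" "proj p n" "gen k g" "gen k h"]
        coset_eq_iff_proj gen_subset[OF g] gen_subset[OF h] by simp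
  qed
  show "(\<lambda>g. ?r (proj p n ` gen k g)) \<in> borel_measurable (Pi\<^sub>M {..<k} (\<lambda>_. \<mu>))"
  proof (rule measurableI)
    fix B :: "real set"
    have "(\<lambda>g. ?r (proj p n ` gen k g)) -` B \<inter> ({..<k} \<rightarrow>\<^sub>E G) \<in> sets (Pi\<^sub>M {..<k} (\<lambda>_. \<mu>))"
    proof (rule I.saturated_sets)
      fix g h
      assume g: "g \<in> (\<lambda>g. ?r (proj p n ` gen k g)) -` B \<inter> ({..<k} \<rightarrow>\<^sub>E G)"
        and h: "h \<in> {..<k} \<rightarrow>\<^sub>E carrier A" and eq: "I.coset_tuple k g = I.coset_tuple k h"
      have "proj p n ` gen k g = proj p n ` gen k h"
        by (rule proj_gen) (use g h eq in auto)
      then show "h \<in> (\<lambda>g. ?r (proj p n ` gen k g)) -` B \<inter> ({..<k} \<rightarrow>\<^sub>E G)"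
        using g h by simp
    qed auto
    then show "(\<lambda>g. ?r (proj p n ` gen k g)) -` B \<inter> space (Pi\<^sub>M {..<k} (\<lambda>_. \<mu>)) \<in> sets (Pi\<^sub>M {..<k} (\<lambda>_. \<mu>))"
      by (simp only: space_PiM_\<mu>)
  qed simp
qed

text \<open>If a tuple generates \<open>G\<close> at every level, then the subgroup that it generates has the same
  sequence of proportions as \<open>G\<close>. The events of generating \<open>G\<close> at level \<open>n\<close> decrease with \<open>n\<close>, so the
  bound that holds for each of them passes to their intersection.\<close>
lemma measure_null_FPP:
  assumes top: "topologically_generated p d G" and k: "d \<le> k" and null: "FPP p G = 0"
  shows "(\<Prod>j<d. 1 - 1 / real p ^ (k - j))
    \<le> measure (Pi\<^sub>M {..<k} (\<lambda>_. \<mu>)) {g \<in> {..<k} \<rightarrow>\<^sub>E G. FPP p (gen k g) = 0}"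
proof -
  let ?P = "Pi\<^sub>M {..<k} (\<lambda>_. \<mu>)"
  interpret P: prob_space ?P by (rule prob_space_PiM_\<mu>)
  define E where "E n = {g \<in> {..<k} \<rightarrow>\<^sub>E G. proj p n ` gen k g = proj p n ` G}" for n
  have E: "E n \<in> sets ?P" "(\<Prod>j<d. 1 - 1 / real p ^ (k - j)) \<le> measure ?P (E n)" for n
    using measure_generates_level[OF top k, of n] by (simp_all add: E_def)
  have "decseq E"
  proof (rule decseq_SucI, rule subsetI)
    fix n g assume g: "g \<in> E (Suc n)"
    have "proj p n ` S = (\<lambda>f. restrict f {v \<in> tree p. length v \<le> n}) ` proj p (Suc n) ` S" for S
      by (simp add: image_image flip: proj_proj)
    then show "g \<in> E n"
      using g by (simp add: E_def)
  qed
  then have "(\<lambda>n. measure ?P (E n)) \<longlonglongrightarrow> measure ?P (\<Inter>n. E n)"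
    using E(1) by (intro P.finite_Lim_measure_decseq) auto
  then have "(\<Prod>j<d. 1 - 1 / real p ^ (k - j)) \<le> measure ?P (\<Inter>n. E n)"
    by (rule LIMSEQ_le_const) (use E(2) in auto)
  also have "\<dots> \<le> measure ?P {g \<in> {..<k} \<rightarrow>\<^sub>E G. FPP p (gen k g) = 0}"
  proof (rule P.finite_measure_mono)
    have "FPP p (gen k g) = FPP p G" if "g \<in> (\<Inter>n. E n)" for g
      using that by (simp add: FPP_def E_def)
    then show "(\<Inter>n. E n) \<subseteq> {g \<in> {..<k} \<rightarrow>\<^sub>E G. FPP p (gen k g) = 0}"
      using null by (auto simp: E_def)
    have "{g \<in> space ?P. FPP p (gen k g) = 0} \<in> sets ?P"
      by (rule borel_measurable_eq[OF FPP_gen_measurable borel_measurable_const])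
    then show "{g \<in> {..<k} \<rightarrow>\<^sub>E G. FPP p (gen k g) = 0} \<in> sets ?P"
      by (simp add: space_PiM_\<mu>)
  qed
  finally show ?thesis .
qed

end

lemma tendsto_prod_one_minus_power:
  assumes "prime p"
  shows "(\<lambda>k. \<Prod>j<d. 1 - 1 / real p ^ (k - j)) \<longlonglongrightarrow> 1"
proof -
  have "(\<lambda>k. 1 / real p ^ (k - j)) \<longlonglongrightarrow> 0" for j
  proof (rule LIMSEQ_offset[of _ j])
    have "(\<lambda>k. inverse (real p ^ k)) \<longlonglongrightarrow> 0"
      using prime_gt_1_nat[OF assms] by (intro LIMSEQ_inverse_realpow_zero) simp
    then show "(\<lambda>k. 1 / real p ^ (k + j - j)) \<longlonglongrightarrow> 0"
      by (simp add: inverse_eq_divide)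
  qed
  then have "(\<lambda>k. \<Prod>j<d. 1 - 1 / real p ^ (k - j)) \<longlonglongrightarrow> (\<Prod>j<d. 1 - 0)"
    by (intro tendsto_prod tendsto_diff tendsto_const)
  then show ?thesis by simp
qed

theorem corollary4:
  fixes p d :: nat
    and \<sigma> :: "nat \<Rightarrow> nat"
    and G :: "(nat list \<Rightarrow> nat list) set"
    and \<mu> :: "(nat list \<Rightarrow> nat list) measure"
  assumes "prime p"
    and "d \<ge> 1"
    and "\<sigma> \<in> p_cycles p"
    and "G \<subseteq> wreath p \<sigma>"
    and "pro_subgroup p p G"
    and "topologically_generated p d G"
    and "normalized_haar_measure p G \<mu>"
    and "FPP p G = 0"
  shows "(\<forall>k\<ge>d. measure (Pi\<^sub>M {..<k} (\<lambda>_. \<mu>))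
            {g \<in> {..<k} \<rightarrow>\<^sub>E G. FPP p (generate (AutT p) (g ` {..<k})) = 0}
          \<ge> (\<Prod>j<d. 1 - 1 / real p ^ (k - j)))
      \<and> (\<lambda>k. measure (Pi\<^sub>M {..<k} (\<lambda>_. \<mu>))
            {g \<in> {..<k} \<rightarrow>\<^sub>E G. FPP p (generate (AutT p) (g ` {..<k})) = 0})
          \<longlonglongrightarrow> 1"
proof -
  interpret haar_pro_group p G \<mu>
    by (rule haar_pro_group.intro) fact+
  let ?m = "\<lambda>k. measure (Pi\<^sub>M {..<k} (\<lambda>_. \<mu>)) {g \<in> {..<k} \<rightarrow>\<^sub>E G. FPP p (gen k g) = 0}"
  have lower: "(\<Prod>j<d. 1 - 1 / real p ^ (k - j)) \<le> ?m k" if "k \<ge> d" for k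
    by (rule measure_null_FPP[OF \<open>topologically_generated p d G\<close> that \<open>FPP p G = 0\<close>])
  have "?m \<longlonglongrightarrow> 1"
  proof (rule tendsto_sandwich[OF _ _ tendsto_prod_one_minus_power[OF \<open>prime p\<close>] tendsto_const])
    show "\<forall>\<^sub>F k in sequentially. (\<Prod>j<d. 1 - 1 / real p ^ (k - j)) \<le> ?m k"
      using lower eventually_sequentially by blast
    show "\<forall>\<^sub>F k in sequentially. ?m k \<le> 1"
      using prob_space.prob_le_1[OF prob_space_PiM_\<mu>] by simp
  qed
  with lower show ?thesis by blast
qed

end
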